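(* Let $P_{X^\ast}$ be the capacity-achieving input distribution of the binomial channel with $n$ trials and $P_{Y^\ast}$ its induced output distribution, and let $P_{Y_r}$ be the Beta-binomial output distribution defined below. Then: (i) With the absolute constant $c_\star:=\frac{1}{4e\,3^{7/4}\pi^{7/4}}$, for every $n\ge1$ and every $y\in\{0,\dots,n\}$, \[ \frac{P_{Y_r}(y)}{P_{Y^\ast}(y)}\ge c_\star. \] (ii) For every $n\ge 444$, \[ D(P_{Y_r}\,\|\,P_{Y^\ast})\le \frac{17}{\log\!\left(\frac{n\pi}{2e}\right)}. \]
   Context: All logarithms are natural. For an integer $n\ge1$, the binomial channel has input $X\in[0,1]$, output $Y\in\{0,\dots,n\}$ and transition law $P_{Y|X}(y|x)=\binom{n}{y}x^y(1-x)^{n-y}$. Its capacity is $C(n)=\max_{P_X} I(X;Y)$ over probability distributions $P_X$ on $[0,1]$; the maximizer $P_{X^\ast}$ (the capacity-achieving input distribution) is unique, and $P_{Y^\ast}$ denotes the output distribution it induces. The reference input is $X_r\sim\mathrm{Beta}(1/2,1/2)$, with density $f_{X_r}(x)=\frac{1}{\pi\sqrt{x(1-x)}}$ on $(0,1)$; its induced output is the Beta-binomial pmf \[ P_{Y_r}(y)=\frac{\Gamma(y+\tfrac12)\Gamma(n-y+\tfrac12)}{\pi\,\Gamma(y+1)\Gamma(n-y+1)},\qquad y=0,\dots,n. \] $D(P\|Q)=\sum_y P(y)\log\frac{P(y)}{Q(y)}$ denotes relative entropy. *)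

theory Defs
  imports "HOL-Probability.Probability"
begin

definition binom_kernel :: "nat \<Rightarrow> real \<Rightarrow> nat \<Rightarrow> real" where
  "binom_kernel n x y = real (n choose y) * x ^ y * (1 - x) ^ (n - y)"

definition input_dist :: "real measure \<Rightarrow> bool" where
  "input_dist M \<longleftrightarrow> prob_space M \<and> sets M = sets borel \<and> emeasure M {0..1} = 1"

definition out_dist :: "nat \<Rightarrow> real measure \<Rightarrow> nat \<Rightarrow> real" where
  "out_dist n M y = (\<integral>x. binom_kernel n x y \<partial>M)"

definition mutual_info :: "nat \<Rightarrow> real measure \<Rightarrow> real" where
  "mutual_info n M =
     (\<integral>x. (\<Sum>y\<le>n. (if binom_kernel n x y = 0 then 0
            else binom_kernel n x y * ln (binom_kernel n x y / out_dist n M y))) \<partial>M)"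

definition capacity_achieving :: "nat \<Rightarrow> real measure \<Rightarrow> bool" where
  "capacity_achieving n M \<longleftrightarrow> input_dist M \<and>
     (\<forall>Q. input_dist Q \<longrightarrow> mutual_info n Q \<le> mutual_info n M)"

text \<open>Beta-binomial output pmf induced by the Beta(1/2,1/2) reference input.\<close>
definition ref_out :: "nat \<Rightarrow> nat \<Rightarrow> real" where
  "ref_out n y = Gamma (real y + 1/2) * Gamma (real n - real y + 1/2)
      / (pi * Gamma (real y + 1) * Gamma (real n - real y + 1))"

definition rel_entropy :: "nat \<Rightarrow> (nat \<Rightarrow> real) \<Rightarrow> (nat \<Rightarrow> real) \<Rightarrow> real" where
  "rel_entropy n P Q = (\<Sum>y\<le>n. if P y = 0 then 0 else P y * ln (P y / Q y))"

end

theory Submission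
  imports Defs "HOL-Real_Asymp.Real_Asymp"
begin

text \<open>
  Let \<open>C\<close> be the capacity, \<open>Q\<close> the optimal output, \<open>L = ln (n * pi / (2 * e))\<close> and
  \<open>v = n * x * (1 - x)\<close>. Perturbing the optimal input towards a point mass yields the
  optimality condition \<open>D(P\<^sub>x \<parallel> Q) \<le> C\<close> for every input \<open>x\<close>, with equality almost surely.
  Integrating it against the arcsine law gives \<open>D(ref \<parallel> Q) \<le> C - I\<close>, where \<open>I\<close> is the average of
  \<open>F x = D(P\<^sub>x \<parallel> ref)\<close>. Stirling bounds and the first four central moments show
  \<open>F x = L / 2 + O(1 / v)\<close>, hence \<open>I \<ge> L / 2 - O(L / n\<^bsup>1/3\<^esup>)\<close>; moreover \<open>F\<close> exceeds \<open>L / 2\<close> by at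
  most a constant near the endpoints.

  Put \<open>x = (sin t)\<^sup>2\<close> and cut \<open>[0, pi / 2]\<close> into about \<open>4 * sqrt n\<close> equal blocks. On a block the
  output laws are within bounded divergence of each other, so the equality case of the optimality
  condition forces its mass to be at most \<open>exp (const - C)\<close>, that is \<open>O(1 / sqrt n)\<close>. Since
  \<open>P\<^sub>x y\<close> is unimodal in \<open>x\<close>, summing over blocks bounds \<open>Q y\<close> by a constant times \<open>ref y\<close>. The same
  bound shows that the optimal input has mass \<open>O(n\<^bsup>-1/3\<^esup>)\<close> near the endpoints, so
  \<open>C \<le> \<integral>F \<le> L / 2 + O(n\<^bsup>-1/3\<^esup>)\<close> and \<open>C - I\<close> is small.
\<close>

subsection \<open>Stirling-type bounds for the Gamma function at half-integers\<close>

text \<open>The argument looks circular: the block bound \<open>exp (const - C)\<close> is of order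
  \<open>1 / sqrt n\<close> only if \<open>C\<close> is already known to be at least
  \<open>L / 2\<close> up to a constant, and the sharp upper bound on \<open>C\<close> in turn rests
  on the block bound. The circle is broken by \<open>D(ref \<parallel> Q) \<ge> 0\<close>: inserted
  into \<open>D(ref \<parallel> Q) \<le> C - I\<close> it gives \<open>C \<ge> I\<close> without any
  knowledge of \<open>Q\<close>. The exponent 1/3 comes from the cut-off angle. Discarding angles
  within \<open>pi / (2 * u)\<close> of either end of \<open>[0, pi / 2]\<close> costs a fraction
  \<open>2 / u\<close> of the average, hence \<open>L / u\<close>, while on the rest
  \<open>v \<ge> n / u\<^sup>2\<close> keeps the Stirling error of order
  \<open>u\<^sup>2 / n\<close>. The choice \<open>u = root 3 n\<close> balances the two up to the
  factor \<open>L\<close>. Since the resulting bound on \<open>D(ref \<parallel> Q)\<close> decays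
  like a power of \<open>n\<close>, claim (ii) is delicate only for moderate \<open>n\<close>; this
  is why every constant is explicit.\<close>

definition stirling_rem :: "nat \<Rightarrow> real" where
  "stirling_rem m = ln (fact m) - (real m + 1/2) * ln (real m) + real m"

text \<open>For the integral of \<open>1 / t\<close> over \<open>[m, m + 1]\<close> the midpoint
  rule gives a lower and the trapezoidal rule an upper estimate. After multiplication by
  \<open>m + 1/2\<close> the first is exactly \<open>1\<close>, and the second exceeds
  \<open>1\<close> by \<open>1 / (4 * m) - 1 / (4 * (m + 1))\<close>, which telescopes.\<close>

lemma stirling_rem_step:
  assumes "m \<ge> 1"
  shows "stirling_rem (Suc m) \<le> stirling_rem m"
    and "stirling_rem m - 1 / (4 * real m) \<le> stirling_rem (Suc m) - 1 / (4 * real (Suc m))"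
proof -
  have m: "real m > 0" using assms by simp
  have d: "stirling_rem m - stirling_rem (Suc m) = (real m + 1/2) * (ln (real m + 1) - ln (real m)) - 1"
  proof -
    have "ln (fact (Suc m)) = ln (real m + 1) + ln (fact m :: real)"
      by (simp add: ln_mult add.commute)
    moreover have "real (Suc m) = real m + 1" by simp
    ultimately show ?thesis by (simp only: stirling_rem_def) (simp add: field_simps)
  qed
  have "ln (real m + 1) - ln (real m) \<ge> 2 * (real m + 1 - real m) / (real m + (real m + 1))"
    using m by (intro ln_inverse_approx_ge) auto
  then have "(real m + 1/2) * (ln (real m + 1) - ln (real m)) \<ge> (real m + 1/2) * (2 / (2 * real m + 1))"
    using m by (intro mult_left_mono) (auto simp: add.commute)
  also have "(real m + 1/2) * (2 / (2 * real m + 1)) = 1" using m by (simp add: field_simps)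
  finally show "stirling_rem (Suc m) \<le> stirling_rem m" using d by linarith
  have "ln (real m + 1) - ln (real m) \<le> 1 * (inverse (real m) + inverse (real m + 1)) / 2"
    using m by (intro ln_inverse_approx_le) auto
  then have "(real m + 1/2) * (ln (real m + 1) - ln (real m)) \<le> (real m + 1/2) * ((inverse (real m) + inverse (real m + 1)) / 2)"
    using m by (intro mult_left_mono) auto
  also have "\<dots> = 1 + 1 / (4 * real m) - 1 / (4 * (real m + 1))"
    using m by (simp add: divide_simps) (simp add: algebra_simps)
  finally show "stirling_rem m - 1 / (4 * real m) \<le> stirling_rem (Suc m) - 1 / (4 * real (Suc m))"
    using d by (simp add: add.commute)
qed

lemma stirling_rem_antimono:
  assumes "1 \<le> m" "m \<le> p" shows "stirling_rem p \<le> stirling_rem m"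
  using assms(2,1) by (induction rule: dec_induct) (auto intro: order.trans[OF stirling_rem_step(1)])

lemma stirling_rem_corrected_mono:
  assumes "1 \<le> m" "m \<le> p"
  shows "stirling_rem m - 1 / (4 * real m) \<le> stirling_rem p - 1 / (4 * real p)"
  using assms(2,1)
proof (induction rule: dec_induct)
  case (step p)
  then show ?case using stirling_rem_step(2)[of p] by linarith
qed simp

lemma half_notin_nonpos_Ints: "real m + 1/2 \<notin> \<int>\<^sub>\<le>\<^sub>0"
  by (auto elim!: nonpos_Ints_cases)

lemma Gamma_half_pos [simp]: "Gamma (real m + 1/2) > 0"
  by (intro Gamma_real_pos) auto

lemma Gamma_half_Suc: "Gamma (real (Suc m) + 1/2) = (real m + 1/2) * Gamma (real m + 1/2)"
  using Gamma_plus1[OF half_notin_nonpos_Ints[of m]] by (simp add: algebra_simps)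

lemma Gamma_half_fact: "Gamma (real m + 1/2) * (4 ^ m * fact m) = sqrt pi * fact (2 * m)"
proof (induction m)
  case 0
  then show ?case by (simp add: Gamma_one_half_real)
next
  case (Suc m)
  have "Gamma (real (Suc m) + 1/2) * (4 ^ Suc m * fact (Suc m))
      = (real m + 1/2) * 4 * (real m + 1) * (Gamma (real m + 1/2) * (4 ^ m * fact m))"
    by (simp only: Gamma_half_Suc) (simp add: algebra_simps)
  also have "\<dots> = sqrt pi * fact (2 * Suc m)"
    by (simp only: Suc) (simp add: algebra_simps)
  finally show ?case .
qed

text \<open>Log-convexity of \<open>Gamma\<close> at midpoints: \<open>m + 1\<close> lies halfway
  between \<open>m + 1/2\<close> and \<open>m + 3/2\<close>, and \<open>m + 1/2\<close> halfway
  between \<open>m\<close> and \<open>m + 1\<close>. These are Wallis' bounds.\<close>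

lemma Gamma_half_sq_bounds:
  shows "(fact m)\<^sup>2 \<le> (real m + 1/2) * (Gamma (real m + 1/2))\<^sup>2"
    and "real m * (Gamma (real m + 1/2))\<^sup>2 \<le> (fact m)\<^sup>2"
proof -
  have mid: "(Gamma ((x + y) / 2))\<^sup>2 \<le> Gamma x * Gamma y" if "x > 0" "y > 0" for x y :: real
  proof -
    have "(ln \<circ> Gamma) ((1 - 1/2) *\<^sub>R x + (1/2) *\<^sub>R y) \<le> (1 - 1/2) * (ln \<circ> Gamma) x + (1/2) * (ln \<circ> Gamma) y"
      using that by (intro convex_onD[OF log_convex_Gamma_real]) auto
    then have "2 * ln (Gamma ((x + y) / 2)) \<le> ln (Gamma x) + ln (Gamma y)"
      by (simp add: add_divide_distrib)
    moreover have "ln ((Gamma ((x + y) / 2))\<^sup>2) = 2 * ln (Gamma ((x + y) / 2))"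
      by (simp add: ln_realpow)
    moreover have "ln (Gamma x * Gamma y) = ln (Gamma x) + ln (Gamma y)"
      using Gamma_real_pos[OF that(1)] Gamma_real_pos[OF that(2)] by (simp add: ln_mult)
    moreover have "Gamma ((x + y) / 2) > 0" "Gamma x > 0" "Gamma y > 0" using that by (auto intro: Gamma_real_pos)
    ultimately show ?thesis
      by (subst ln_le_cancel_iff[symmetric]) auto
  qed
  have f: "Gamma (real m + 1) = fact m" for m using Gamma_fact[of m, where 'a=real] by (simp add: add.commute)
  have "(Gamma (((real m + 1/2) + (real (Suc m) + 1/2)) / 2))\<^sup>2 \<le> Gamma (real m + 1/2) * Gamma (real (Suc m) + 1/2)"
    by (intro mid) auto
  also have "((real m + 1/2) + (real (Suc m) + 1/2)) / 2 = real m + 1" by simp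
  finally show "(fact m)\<^sup>2 \<le> (real m + 1/2) * (Gamma (real m + 1/2))\<^sup>2"
    by (simp only: Gamma_half_Suc f) (simp add: power2_eq_square algebra_simps)
  show "real m * (Gamma (real m + 1/2))\<^sup>2 \<le> (fact m)\<^sup>2"
  proof (cases m)
    case (Suc k)
    have "(Gamma (((real k + 1) + (real m + 1)) / 2))\<^sup>2 \<le> Gamma (real k + 1) * Gamma (real m + 1)"
      by (intro mid) auto
    also have "((real k + 1) + (real m + 1)) / 2 = real m + 1/2" using Suc by simp
    finally have "(Gamma (real m + 1/2))\<^sup>2 \<le> fact k * fact m" by (simp only: f)
    then have "real m * (Gamma (real m + 1/2))\<^sup>2 \<le> real m * (fact k * fact m)"
      by (intro mult_left_mono) auto
    also have "\<dots> = (fact m)\<^sup>2" using Suc by (simp add: power2_eq_square)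
    finally show ?thesis .
  qed simp
qed

text \<open>The logarithm of the duplication identity \<open>Gamma_half_fact\<close>. It reduces
  half-integer values to \<open>fact m\<close> and \<open>fact (2 * m)\<close>, so a single monotone
  remainder sequence controls everything.\<close>

lemma ln_Gamma_half_stirling:
  assumes "m \<ge> 1"
  shows "ln (Gamma (real m + 1/2)) = real m * ln (real m) - real m + ln (2 * pi) / 2
           + stirling_rem (2 * m) - stirling_rem m"
proof -
  have m: "real m > 0" using assms by simp
  have "ln (Gamma (real m + 1/2) * (4 ^ m * fact m)) = ln (sqrt pi * fact (2 * m))"
    by (simp only: Gamma_half_fact)
  then have "ln (Gamma (real m + 1/2)) + real m * ln 4 + ln (fact m) = ln pi / 2 + ln (fact (2 * m))"
    by (simp add: ln_mult ln_realpow ln_sqrt less_imp_neq[OF Gamma_half_pos, symmetric])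
  moreover have "ln (4::real) = 2 * ln 2" using ln_realpow[of 2 2] by simp
  moreover have "ln (2 * real m) = ln 2 + ln (real m)" "ln (2 * pi) = ln 2 + ln pi" using m by (simp_all add: ln_mult)
  ultimately show ?thesis using m by (simp add: stirling_rem_def field_simps)
qed

lemma Gamma_half_ratio_tendsto:
  "(\<lambda>m. real m * (Gamma (real m + 1/2))\<^sup>2 / (fact m)\<^sup>2) \<longlonglongrightarrow> 1"
proof (rule tendsto_sandwich)
  show "\<forall>\<^sub>F m in sequentially. real m / (real m + 1/2) \<le> real m * (Gamma (real m + 1/2))\<^sup>2 / (fact m)\<^sup>2"
  proof (rule always_eventually, rule allI)
    fix m :: nat
    have "1 / (real m + 1/2) \<le> (Gamma (real m + 1/2))\<^sup>2 / (fact m)\<^sup>2"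
      using Gamma_half_sq_bounds(1)[of m] by (simp add: divide_le_eq le_divide_eq field_simps)
    then have "real m * (1 / (real m + 1/2)) \<le> real m * ((Gamma (real m + 1/2))\<^sup>2 / (fact m)\<^sup>2)"
      by (intro mult_left_mono) auto
    then show "real m / (real m + 1/2) \<le> real m * (Gamma (real m + 1/2))\<^sup>2 / (fact m)\<^sup>2" by simp
  qed
  show "\<forall>\<^sub>F m in sequentially. real m * (Gamma (real m + 1/2))\<^sup>2 / (fact m)\<^sup>2 \<le> 1"
    using Gamma_half_sq_bounds(2) by (intro always_eventually) (auto simp: divide_le_eq)
  show "(\<lambda>m. real m / (real m + 1/2)) \<longlonglongrightarrow> 1" by real_asymp
qed auto

text \<open>The limit exists by monotonicity and is identified by Wallis' ratio, written as
  \<open>ln (2 * pi) + 2 * stirling_rem (2 * m) - 4 * stirling_rem m\<close>.\<close>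
lemma stirling_rem_tendsto: "stirling_rem \<longlonglongrightarrow> ln (2 * pi) / 2"
proof -
  have "decseq (\<lambda>m. stirling_rem (Suc m))" unfolding decseq_def
    using stirling_rem_antimono by auto
  moreover have "stirling_rem (Suc m) \<ge> stirling_rem 1 - 1/4" for m
  proof -
    have "1 / (4 * real (Suc m)) \<ge> 0" by simp
    then show ?thesis using stirling_rem_corrected_mono[of 1 "Suc m"] by linarith
  qed
  ultimately obtain c where "(\<lambda>m. stirling_rem (Suc m)) \<longlonglongrightarrow> c"
    by (metis decseq_convergent)
  then have c: "stirling_rem \<longlonglongrightarrow> c" by (simp only: filterlim_sequentially_Suc)
  have "(\<lambda>m. stirling_rem (2 * m)) \<longlonglongrightarrow> c"
    using LIMSEQ_subseq_LIMSEQ[OF c, of "\<lambda>m. 2 * m"] by (simp add: strict_mono_def o_def)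
  then have 1: "(\<lambda>m. ln (2 * pi) + 2 * stirling_rem (2 * m) - 4 * stirling_rem m) \<longlonglongrightarrow> ln (2 * pi) + 2 * c - 4 * c"
    by (intro tendsto_intros c)
  have 2: "(\<lambda>m. ln (real m * (Gamma (real m + 1/2))\<^sup>2 / (fact m)\<^sup>2)) \<longlonglongrightarrow> ln 1"
    by (intro tendsto_ln Gamma_half_ratio_tendsto) simp
  have "\<forall>\<^sub>F m in sequentially. ln (real m * (Gamma (real m + 1/2))\<^sup>2 / (fact m)\<^sup>2)
      = ln (2 * pi) + 2 * stirling_rem (2 * m) - 4 * stirling_rem m"
    using eventually_ge_at_top[of 1]
  proof eventually_elim
    case (elim m)
    then have m: "real m > 0" by simp
    have "ln (real m * (Gamma (real m + 1/2))\<^sup>2 / (fact m)\<^sup>2)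
        = ln (real m) + 2 * ln (Gamma (real m + 1/2)) - 2 * ln (fact m)"
      using m by (simp add: ln_mult ln_div ln_realpow less_imp_neq[OF Gamma_half_pos, symmetric])
    then show ?case using ln_Gamma_half_stirling[OF elim] m
      by (simp add: stirling_rem_def[of m] algebra_simps)
  qed
  from tendsto_cong[OF this] 2 have "(\<lambda>m. ln (2 * pi) + 2 * stirling_rem (2 * m) - 4 * stirling_rem m) \<longlonglongrightarrow> ln 1"
    by simp
  from LIMSEQ_unique[OF this 1] have "c = ln (2 * pi) / 2" by simp
  with c show ?thesis by simp
qed

lemma stirling_rem_bounds:
  assumes "m \<ge> 1"
  shows "ln (2 * pi) / 2 \<le> stirling_rem m" "stirling_rem m \<le> ln (2 * pi) / 2 + 1 / (4 * real m)"
proof -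
  show "ln (2 * pi) / 2 \<le> stirling_rem m"
    by (rule LIMSEQ_le_const2[OF stirling_rem_tendsto]) (use stirling_rem_antimono assms in auto)
  have "(\<lambda>p. stirling_rem p - 1 / (4 * real p)) \<longlonglongrightarrow> ln (2 * pi) / 2 - 0"
    by (intro tendsto_diff stirling_rem_tendsto) real_asymp
  then have "stirling_rem m - 1 / (4 * real m) \<le> ln (2 * pi) / 2 - 0"
    by (rule LIMSEQ_le_const) (use stirling_rem_corrected_mono assms in blast)
  then show "stirling_rem m \<le> ln (2 * pi) / 2 + 1 / (4 * real m)" by simp
qed

text \<open>Here \<open>ln 0 = 0\<close>, which makes the case \<open>m = 0\<close> the correct continuous extension.\<close>
definition gamma_half_rem :: "nat \<Rightarrow> real" where
  "gamma_half_rem m = ln (Gamma (real m + 1/2)) - real m * ln (real m) + real m"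

lemma gamma_half_rem_le: "gamma_half_rem m \<le> ln (2 * pi) / 2"
proof (cases "m = 0")
  case True
  have "ln pi \<le> ln (2 * pi)" using pi_gt_zero by (subst ln_le_cancel_iff) auto
  then show ?thesis using True by (simp add: gamma_half_rem_def Gamma_one_half_real ln_sqrt)
next
  case False
  then show ?thesis using ln_Gamma_half_stirling[of m] stirling_rem_antimono[of m "2 * m"]
    by (simp add: gamma_half_rem_def)
qed

text \<open>The constant \<open>7/20\<close> is dictated by \<open>m = 0\<close>, where the deficit
  is \<open>ln 2 / 2\<close>; for \<open>m \<ge> 1\<close> the deficit is at most
  \<open>1 / (8 * m)\<close>. The denominator \<open>m + 1\<close> covers \<open>m = 0\<close> and
  has an explicit binomial expectation.\<close>

lemma gamma_half_rem_ge: "gamma_half_rem m \<ge> ln (2 * pi) / 2 - 7/20 / (real m + 1)"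
proof (cases "m = 0")
  case True
  have "ln (2 * pi) = ln 2 + ln pi" by (simp add: ln_mult)
  then show ?thesis using True ln2_le_25_over_36
    by (simp add: gamma_half_rem_def Gamma_one_half_real ln_sqrt add_divide_distrib)
next
  case False
  then have m: "real m \<ge> 1" by simp
  have "1 / (4 * real m) - 1 / (4 * real (2 * m)) \<le> 7/20 / (real m + 1)"
    using m by (simp add: divide_simps)
  then show ?thesis using ln_Gamma_half_stirling[of m] stirling_rem_corrected_mono[of m "2 * m"] False
    unfolding gamma_half_rem_def by simp
qed

text \<open>Equality holds at \<open>m = 0\<close>. This serves the smaller of the two counts
  \<open>y\<close> and \<open>n - y\<close>, for which \<open>7/20 / (m + 1)\<close> need not be
  small.\<close>

lemma gamma_half_rem_ge_0: "gamma_half_rem m \<ge> ln pi / 2"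
proof (cases "m = 0")
  case True
  then show ?thesis by (simp add: gamma_half_rem_def Gamma_one_half_real ln_sqrt)
next
  case False
  have "ln (2 * pi) / 2 = ln 2 / 2 + ln pi / 2" by (simp add: ln_mult add_divide_distrib)
  moreover have "7/20 / (real m + 1) \<le> 7/20 / 2"
    using False by (intro divide_left_mono) auto
  ultimately show ?thesis
    using gamma_half_rem_ge[of m] ln2_ge_two_thirds by linarith
qed

subsection \<open>The binomial kernel and the Beta-binomial output\<close>

lemma binom_kernel_nonneg [simp]: "0 \<le> x \<Longrightarrow> x \<le> 1 \<Longrightarrow> binom_kernel n x y \<ge> 0"
  by (simp add: binom_kernel_def)

lemma binom_kernel_pos: "0 < x \<Longrightarrow> x < 1 \<Longrightarrow> y \<le> n \<Longrightarrow> binom_kernel n x y > 0"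
  by (simp add: binom_kernel_def)

lemma sum_binom_kernel [simp]: "(\<Sum>y\<le>n. binom_kernel n x y) = 1"
  using binomial_ring[of x "1 - x" n] by (simp add: binom_kernel_def)

lemma binom_kernel_le_1:
  assumes "0 \<le> x" "x \<le> 1" "y \<le> n" shows "binom_kernel n x y \<le> 1"
  using member_le_sum[of y "{..n}" "binom_kernel n x"] assms by simp

text \<open>Integration by parts of \<open>sin t ^ (2 * a + 1) * cos t ^ (2 * b + 1)\<close>, which vanishes at both ends.\<close>
lemma wallis_integral_step:
  fixes I :: real
  assumes "((\<lambda>t. sin t ^ (2 * a) * cos t ^ (2 * b)) has_integral I) {0..pi/2}"
  shows "((\<lambda>t. sin t ^ (2 * Suc a) * cos t ^ (2 * b)) has_integral (real a + 1/2) / real (Suc (a + b)) * I) {0..pi/2}"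
    and "((\<lambda>t. sin t ^ (2 * a) * cos t ^ (2 * Suc b)) has_integral (real b + 1/2) / real (Suc (a + b)) * I) {0..pi/2}"
proof -
  let ?S = "\<lambda>t::real. sin t ^ (2 * a) * cos t ^ (2 * b)"
  let ?G = "\<lambda>t::real. sin t ^ (2 * a + 1) * cos t ^ (2 * b + 1)"
  let ?G' = "\<lambda>t::real. (2 * real a + 1) * ?S t * (cos t)\<^sup>2 - (2 * real b + 1) * ?S t * (sin t)\<^sup>2"
  have "(?G' has_integral (?G (pi/2) - ?G 0)) {0..pi/2}"
  proof (rule fundamental_theorem_of_calculus)
    fix x :: real
    have "(?G has_real_derivative ?G' x) (at x within {0..pi/2})"
    proof -
      have "((\<lambda>t. sin t ^ (2 * a + 1)) has_real_derivative (2 * real a + 1) * (cos x * sin x ^ (2 * a))) (at x within {0..pi/2})"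
        using DERIV_power[OF has_field_derivative_at_within[OF DERIV_sin], where x = x and s = "{0..pi/2}" and n = "2 * a + 1"] by (simp add: add.commute)
      moreover have "((\<lambda>t. cos t ^ (2 * b + 1)) has_real_derivative (2 * real b + 1) * (- sin x * cos x ^ (2 * b))) (at x within {0..pi/2})"
        using DERIV_power[OF has_field_derivative_at_within[OF DERIV_cos], where x = x and s = "{0..pi/2}" and n = "2 * b + 1"] by (simp add: add.commute)
      ultimately have "(?G has_real_derivative (2 * real a + 1) * (cos x * sin x ^ (2 * a)) * cos x ^ (2 * b + 1)
          + (2 * real b + 1) * (- sin x * cos x ^ (2 * b)) * sin x ^ (2 * a + 1)) (at x within {0..pi/2})"
        by (rule DERIV_mult)
      then show ?thesis
        by (rule DERIV_cong) (simp add: power2_eq_square algebra_simps)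
    qed
    then show "(?G has_vector_derivative ?G' x) (at x within {0..pi/2})"
      by (simp add: has_real_derivative_iff_has_vector_derivative)
  qed simp
  then have G: "(?G' has_integral 0) {0..pi/2}" by simp
  have *: "(cos t)\<^sup>2 = 1 - (sin t)\<^sup>2" for t :: real by (rule cos_squared_eq)
  have "((\<lambda>t. ((2 * real a + 1) * ?S t - ?G' t) * (1 / (2 * real (Suc (a + b))))) has_integral
      ((2 * real a + 1) * I - 0) * (1 / (2 * real (Suc (a + b))))) {0..pi/2}"
    by (intro has_integral_mult_left has_integral_diff has_integral_mult_right assms G)
  moreover have "((2 * real a + 1) * ?S t - ?G' t) * (1 / (2 * real (Suc (a + b)))) = sin t ^ (2 * Suc a) * cos t ^ (2 * b)" for t
  proof -
    have "(2 * real a + 1) * ?S t - ?G' t = 2 * real (Suc (a + b)) * (?S t * (sin t)\<^sup>2)"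
      unfolding * by (simp add: algebra_simps)
    then have "((2 * real a + 1) * ?S t - ?G' t) * (1 / (2 * real (Suc (a + b)))) = 2 * real (Suc (a + b)) * (?S t * (sin t)\<^sup>2) * (1 / (2 * real (Suc (a + b))))"
      by (rule arg_cong)
    also have "\<dots> = ?S t * (sin t)\<^sup>2" by simp
    also have "\<dots> = sin t ^ (2 * Suc a) * cos t ^ (2 * b)" by (simp add: power2_eq_square)
    finally show ?thesis .
  qed
  moreover have "((2 * real a + 1) * I - 0) * (1 / (2 * real (Suc (a + b)))) = (real a + 1/2) / real (Suc (a + b)) * I"
    by (simp add: field_simps)
  ultimately show "((\<lambda>t. sin t ^ (2 * Suc a) * cos t ^ (2 * b)) has_integral (real a + 1/2) / real (Suc (a + b)) * I) {0..pi/2}"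
    by (simp only:)
  have "((\<lambda>t. ((2 * real b + 1) * ?S t + ?G' t) * (1 / (2 * real (Suc (a + b))))) has_integral
      ((2 * real b + 1) * I + 0) * (1 / (2 * real (Suc (a + b))))) {0..pi/2}"
    by (intro has_integral_mult_left has_integral_add has_integral_mult_right assms G)
  moreover have "((2 * real b + 1) * ?S t + ?G' t) * (1 / (2 * real (Suc (a + b)))) = sin t ^ (2 * a) * cos t ^ (2 * Suc b)" for t
  proof -
    have "(2 * real b + 1) * ?S t + ?G' t = 2 * real (Suc (a + b)) * (?S t * (cos t)\<^sup>2)"
      unfolding sin_squared_eq by (simp add: algebra_simps)
    then have "((2 * real b + 1) * ?S t + ?G' t) * (1 / (2 * real (Suc (a + b)))) = 2 * real (Suc (a + b)) * (?S t * (cos t)\<^sup>2) * (1 / (2 * real (Suc (a + b))))"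
      by (rule arg_cong)
    also have "\<dots> = ?S t * (cos t)\<^sup>2" by simp
    also have "\<dots> = sin t ^ (2 * a) * cos t ^ (2 * Suc b)" by (simp add: power2_eq_square)
    finally show ?thesis .
  qed
  moreover have "((2 * real b + 1) * I + 0) * (1 / (2 * real (Suc (a + b)))) = (real b + 1/2) / real (Suc (a + b)) * I"
    by (simp add: field_simps)
  ultimately show "((\<lambda>t. sin t ^ (2 * a) * cos t ^ (2 * Suc b)) has_integral (real b + 1/2) / real (Suc (a + b)) * I) {0..pi/2}"
    by (simp only:)
qed

lemma wallis_integral:
  "((\<lambda>t. sin t ^ (2 * a) * cos t ^ (2 * b)) has_integral
     Gamma (real a + 1/2) * Gamma (real b + 1/2) / (2 * fact (a + b))) {0..pi/2}"
proof (induction a)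
  case 0
  show ?case
  proof (induction b)
    case 0
    have "((\<lambda>t. 1::real) has_integral (pi/2)) {0..pi/2}"
      using has_integral_const_real[of "1::real" 0 "pi/2"] by simp
    then show ?case by (simp add: Gamma_one_half_real)
  next
    case (Suc b)
    have eq: "(real b + 1/2) / real (Suc (0 + b)) * (Gamma (real 0 + 1/2) * Gamma (real b + 1/2) / (2 * fact (0 + b)))
        = Gamma (real 0 + 1/2) * Gamma (real (Suc b) + 1/2) / (2 * fact (0 + Suc b))"
      by (simp only: Gamma_half_Suc) (simp add: field_simps)
    show ?case using wallis_integral_step(2)[OF Suc] unfolding eq .
  qed
next
  case (Suc a)
  have eq: "(real a + 1/2) / real (Suc (a + b)) * (Gamma (real a + 1/2) * Gamma (real b + 1/2) / (2 * fact (a + b)))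
      = Gamma (real (Suc a) + 1/2) * Gamma (real b + 1/2) / (2 * fact (Suc a + b))"
    by (simp only: Gamma_half_Suc) (simp add: field_simps)
  show ?case using wallis_integral_step(1)[OF Suc] unfolding eq .
qed

lemma ref_out_eq:
  assumes "y \<le> n"
  shows "ref_out n y = Gamma (real y + 1/2) * Gamma (real (n - y) + 1/2) / (pi * fact y * fact (n - y))"
proof -
  have f: "Gamma (real m + 1) = fact m" for m using Gamma_fact[of m, where 'a=real] by (simp add: add.commute)
  have d: "real n - real y = real (n - y)" using assms by simp
  show ?thesis unfolding ref_out_def d f by simp
qed

lemma ref_out_pos: "y \<le> n \<Longrightarrow> ref_out n y > 0"
  by (simp add: ref_out_eq)

text \<open>Under \<open>x = (sin t)\<^sup>2\<close> the arcsine law becomes the uniform law on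
  \<open>[0, pi / 2]\<close>. Averages over the reference input are therefore taken as integrals in
  \<open>t\<close>, and no Beta measure is constructed.\<close>

lemma has_integral_binom_kernel_sin:
  assumes "y \<le> n"
  shows "((\<lambda>t. binom_kernel n ((sin t)\<^sup>2) y) has_integral (pi / 2 * ref_out n y)) {0..pi/2}"
proof -
  have "((\<lambda>t. real (n choose y) * (sin t ^ (2 * y) * cos t ^ (2 * (n - y)))) has_integral
      real (n choose y) * (Gamma (real y + 1/2) * Gamma (real (n - y) + 1/2) / (2 * fact (y + (n - y))))) {0..pi/2}"
    by (intro has_integral_mult_right wallis_integral)
  moreover have "real (n choose y) * (Gamma (real y + 1/2) * Gamma (real (n - y) + 1/2) / (2 * fact (y + (n - y)))) = pi / 2 * ref_out n y"
    using assms by (simp add: ref_out_eq binomial_fact)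
  moreover have "real (n choose y) * (sin t ^ (2 * y) * cos t ^ (2 * (n - y))) = binom_kernel n ((sin t)\<^sup>2) y" for t
    by (simp add: binom_kernel_def cos_squared_eq[symmetric] power_mult)
  ultimately show ?thesis by (simp only:)
qed

lemma sum_ref_out: "(\<Sum>y\<le>n. ref_out n y) = 1"
proof -
  have "((\<lambda>t. \<Sum>y\<le>n. binom_kernel n ((sin t)\<^sup>2) y) has_integral (\<Sum>y\<le>n. pi / 2 * ref_out n y)) {0..pi/2}"
    by (intro has_integral_sum has_integral_binom_kernel_sin) auto
  moreover have "((\<lambda>t. 1::real) has_integral (pi/2)) {0..pi/2}"
    using has_integral_const_real[of "1::real" 0 "pi/2"] by simp
  ultimately have "(\<Sum>y\<le>n. pi / 2 * ref_out n y) = pi / 2"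
    unfolding sum_binom_kernel by (rule has_integral_unique)
  then show ?thesis by (simp only: sum_distrib_left[symmetric]) simp
qed

text \<open>Multiply the lower Wallis bounds for \<open>y\<close> and \<open>n - y\<close>, then
  apply the inequality of arithmetic and geometric means to
  \<open>(y + 1/2) * (n - y + 1/2)\<close>. This settles the ratio bound for small
  \<open>n\<close>.\<close>

lemma ref_out_ge:
  assumes "y \<le> n" shows "ref_out n y \<ge> 2 / (pi * (real n + 1))"
proof -
  have W: "1 \<le> (real m + 1/2) * (Gamma (real m + 1/2) / fact m)\<^sup>2" for m
    using Gamma_half_sq_bounds(1)[of m] by (simp add: power_divide)
  let ?a = "Gamma (real y + 1/2) / fact y" and ?b = "Gamma (real (n - y) + 1/2) / fact (n - y)"
  have "1 * 1 \<le> ((real y + 1/2) * ?a\<^sup>2) * ((real (n - y) + 1/2) * ?b\<^sup>2)"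
    using W[of y] W[of "n - y"] by (intro mult_mono) auto
  also have "\<dots> = ((real y + 1/2) * (real (n - y) + 1/2)) * (?a * ?b)\<^sup>2"
    by (simp only: power_mult_distrib) (simp only: mult_ac)
  also have "\<dots> \<le> ((real n + 1) / 2)\<^sup>2 * (?a * ?b)\<^sup>2"
  proof (intro mult_right_mono)
    have n: "real n = real y + real (n - y)" using assms by simp
    have "((real n + 1) / 2)\<^sup>2 - (real y + 1/2) * (real (n - y) + 1/2) = ((real y - real (n - y)) / 2)\<^sup>2"
      unfolding n by (simp add: power2_eq_square field_simps)
    then show "(real y + 1/2) * (real (n - y) + 1/2) \<le> ((real n + 1) / 2)\<^sup>2"
      by (smt (verit) zero_le_power2)
  qed simp
  finally have "1\<^sup>2 \<le> (((real n + 1) / 2) * (?a * ?b))\<^sup>2"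
    by (simp only: power_mult_distrib) simp
  then have "1 \<le> ((real n + 1) / 2) * (?a * ?b)"
    by (rule power2_le_imp_le) (simp add: less_imp_le)
  moreover have "?a * ?b = pi * ref_out n y" using assms by (simp add: ref_out_eq)
  ultimately have "1 \<le> ((real n + 1) / 2) * (pi * ref_out n y)" by metis
  moreover have "pi * (real n + 1) > 0" by simp
  ultimately show ?thesis by (simp add: divide_le_eq mult_ac)
qed

subsection \<open>Central moments and the divergence from the reference output\<close>

text \<open>The cubic Taylor polynomial at \<open>0\<close> stays below on the whole range because
  the second derivative of the difference is \<open>t\<^sup>2 / (1 + t)\<close>. The cubic term is
  kept since its binomial mean is of order \<open>1 / v\<close>, like the final error.\<close>

lemma entropy_taylor_lower:
  fixes w :: real
  assumes "w \<ge> -1"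
  shows "(1 + w) * ln (1 + w) \<ge> w + w\<^sup>2 / 2 - w ^ 3 / 6"
proof (cases "w = -1")
  case False
  then have w: "w > -1" using assms by simp
  let ?g = "\<lambda>w::real. (1 + w) * ln (1 + w) - w - w\<^sup>2 / 2 + w ^ 3 / 6"
  let ?g' = "\<lambda>w::real. ln (1 + w) - w + w\<^sup>2 / 2"
  have g: "(?g has_real_derivative ?g' t) (at t)" if "t > -1" for t
    using that by (auto intro!: derivative_eq_intros simp: power2_eq_square divide_simps) (simp_all add: algebra_simps)?
  have g': "(?g' has_real_derivative t\<^sup>2 / (1 + t)) (at t)" if "t > -1" for t
    using that by (auto intro!: derivative_eq_intros simp: power2_eq_square divide_simps) (simp_all add: algebra_simps)?
  have mono': "?g' s \<le> ?g' t" if "-1 < s" "s \<le> t" for s t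
    using that(2)
  proof (rule DERIV_nonneg_imp_nondecreasing)
    fix x assume x: "s \<le> x" "x \<le> t"
    have "x\<^sup>2 / (1 + x) \<ge> 0" using x that by auto
    then show "\<exists>y. (?g' has_real_derivative y) (at x) \<and> 0 \<le> y" using g'[of x] x that by (intro exI conjI) auto
  qed
  have "?g 0 \<le> ?g w"
  proof (cases "w \<ge> 0")
    case True
    then show ?thesis
    proof (rule DERIV_nonneg_imp_nondecreasing)
      fix x assume x: "0 \<le> x" "x \<le> w"
      show "\<exists>y. (?g has_real_derivative y) (at x) \<and> 0 \<le> y"
        using g[of x] mono'[of 0 x] x by (intro exI[of _ "?g' x"]) auto
    qed
  next
    case False
    then have "w \<le> 0" by simp
    then show ?thesis
    proof (rule DERIV_nonpos_imp_nonincreasing)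
      fix x assume x: "w \<le> x" "x \<le> 0"
      show "\<exists>y. (?g has_real_derivative y) (at x) \<and> y \<le> 0"
        using g[of x] mono'[of x 0] x w by (intro exI[of _ "?g' x"]) auto
    qed
  qed
  then show ?thesis by simp
qed simp

text \<open>The Taylor coefficient would be \<open>1/12\<close>, but at \<open>w = -1\<close> the
  quartic term has to make up \<open>1/3\<close>. With \<open>3/5\<close> the second derivative of
  the difference is nonnegative for \<open>t \<ge> -31/36\<close>, a range containing
  \<open>-6/7\<close>; below \<open>-6/7\<close> the crude \<open>ln (1 + w) \<le> w\<close> is
  enough.\<close>

lemma entropy_taylor_upper:
  fixes w :: real
  assumes "w \<ge> -1"
  shows "(1 + w) * ln (1 + w) \<le> w + w\<^sup>2 / 2 - w ^ 3 / 6 + 3/5 * w ^ 4"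
proof (cases "w \<ge> -6/7")
  case False
  then have w: "w < -6/7" by simp
  have 1: "(1 + w) * ln (1 + w) \<le> (1 + w) * w"
  proof (cases "w = -1")
    case False
    then show ?thesis using assms ln_le_minus_one[of "1 + w"] by (intro mult_left_mono) auto
  qed simp
  \<comment> \<open>The product is \<open>3/5 * w\<^sup>2 - w / 6\<close> minus its value at
    \<open>-6/7\<close>, and that value exceeds \<open>1/2\<close>.\<close>
  have "(w + 6/7) * (3/5 * w - 1/6 - 18/35) \<ge> 0"
    using w by (intro mult_nonpos_nonpos) auto
  then have "3/5 * w\<^sup>2 - w / 6 - 1/2 \<ge> 0" using w
    by (simp add: power2_eq_square field_simps)
  then have "w\<^sup>2 * (3/5 * w\<^sup>2 - w / 6 - 1/2) \<ge> 0" by simp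
  then have "w + w\<^sup>2 / 2 - w ^ 3 / 6 + 3/5 * w ^ 4 \<ge> (1 + w) * w"
    by (simp add: power2_eq_square power3_eq_cube power4_eq_xxxx field_simps)
  with 1 show ?thesis by linarith
next
  case True
  let ?g = "\<lambda>w::real. w + w\<^sup>2 / 2 - w ^ 3 / 6 + 3/5 * w ^ 4 - (1 + w) * ln (1 + w)"
  let ?g' = "\<lambda>w::real. w - w\<^sup>2 / 2 + 12/5 * w ^ 3 - ln (1 + w)"
  have g: "(?g has_real_derivative ?g' t) (at t)" if "t > -1" for t
    using that by (auto intro!: derivative_eq_intros simp: power2_eq_square divide_simps) (simp_all add: algebra_simps)?
  have g': "(?g' has_real_derivative t\<^sup>2 * (31/5 + 36/5 * t) / (1 + t)) (at t)" if "t > -1" for t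
    using that by (auto intro!: derivative_eq_intros simp: power2_eq_square divide_simps power3_eq_cube) (simp_all add: algebra_simps)?
  have mono': "?g' s \<le> ?g' t" if "-6/7 \<le> s" "s \<le> t" for s t
    using that(2)
  proof (rule DERIV_nonneg_imp_nondecreasing)
    fix x assume x: "s \<le> x" "x \<le> t"
    have "x\<^sup>2 * (31/5 + 36/5 * x) / (1 + x) \<ge> 0" using x that by (intro divide_nonneg_nonneg mult_nonneg_nonneg) auto
    then show "\<exists>y. (?g' has_real_derivative y) (at x) \<and> 0 \<le> y" using g'[of x] x that by (intro exI conjI) auto
  qed
  have "?g 0 \<le> ?g w"
  proof (cases "w \<ge> 0")
    case w: True
    then show ?thesis
    proof (rule DERIV_nonneg_imp_nondecreasing)
      fix x assume x: "0 \<le> x" "x \<le> w"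
      show "\<exists>y. (?g has_real_derivative y) (at x) \<and> 0 \<le> y"
        using g[of x] mono'[of 0 x] x by (intro exI[of _ "?g' x"]) auto
    qed
  next
    case False
    then have "w \<le> 0" by simp
    then show ?thesis
    proof (rule DERIV_nonpos_imp_nonincreasing)
      fix x assume x: "w \<le> x" "x \<le> 0"
      show "\<exists>y. (?g has_real_derivative y) (at x) \<and> y \<le> 0"
        using g[of x] mono'[of x 0] x True by (intro exI[of _ "?g' x"]) auto
    qed
  qed
  then show ?thesis by simp
qed

lemma xlogx_bounds:
  fixes t a :: real
  assumes "t \<ge> 0" "a > 0"
  shows "t * ln t - t * ln a \<ge> t - a"
    and "t * ln t - t * ln a \<ge> (t - a) + (t - a)\<^sup>2 / (2 * a) - (t - a) ^ 3 / (6 * a\<^sup>2)"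
    and "t * ln t - t * ln a \<le> (t - a) + (t - a)\<^sup>2 / (2 * a) - (t - a) ^ 3 / (6 * a\<^sup>2) + 3/5 * ((t - a) ^ 4 / a ^ 3)"
proof -
  define w where "w = (t - a) / a"
  have w: "w \<ge> -1" "1 + w = t / a" using assms by (simp_all add: w_def field_simps)
  have eq: "t * ln t - t * ln a = a * ((1 + w) * ln (1 + w))"
    using assms by (cases "t = 0") (simp_all add: w(2) ln_div field_simps)
  have d: "t - a = a * w" using assms by (simp add: w_def)
  show "t * ln t - t * ln a \<ge> (t - a) + (t - a)\<^sup>2 / (2 * a) - (t - a) ^ 3 / (6 * a\<^sup>2)"
    using mult_left_mono[OF entropy_taylor_lower[OF w(1)], of a] assms unfolding eq d
    by (simp add: field_simps power2_eq_square power3_eq_cube)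
  show "t * ln t - t * ln a \<le> (t - a) + (t - a)\<^sup>2 / (2 * a) - (t - a) ^ 3 / (6 * a\<^sup>2) + 3/5 * ((t - a) ^ 4 / a ^ 3)"
    using mult_left_mono[OF entropy_taylor_upper[OF w(1)], of a] assms unfolding eq d
    by (simp add: field_simps power2_eq_square power3_eq_cube power4_eq_xxxx)
  show "t * ln t - t * ln a \<ge> t - a"
  proof (cases "t = 0")
    case False
    then have "t * ln (a / t) \<le> t * (a / t - 1)" using assms by (intro mult_left_mono ln_le_minus_one) auto
    moreover have "t * (a / t - 1) = a - t" using False by (simp add: right_diff_distrib)
    ultimately show ?thesis using False assms by (simp add: ln_div right_diff_distrib)
  qed (use assms in simp)
qed

section \<open>Central and reciprocal moments of the binomial law\<close>

lemma sum_binom_kernel_Suc: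
  "(\<Sum>y\<le>Suc n. binom_kernel (Suc n) x y * f y)
     = (1 - x) * (\<Sum>y\<le>n. binom_kernel n x y * f y) + x * (\<Sum>y\<le>n. binom_kernel n x y * f (Suc y))"
proof -
  have k0: "binom_kernel (Suc n) x 0 = (1 - x) * binom_kernel n x 0" by (simp add: binom_kernel_def)
  have top: "binom_kernel n x (Suc n) = 0" by (simp add: binom_kernel_def)
  have kS: "binom_kernel (Suc n) x (Suc y) = x * binom_kernel n x y + (1 - x) * binom_kernel n x (Suc y)" if "y \<le> n" for y
  proof (cases "y = n")
    case True
    then show ?thesis by (simp add: binom_kernel_def)
  next
    case False
    then have "n - y = Suc (n - Suc y)" using that by simp
    then show ?thesis by (simp add: binom_kernel_def algebra_simps)
  qed
  have "(\<Sum>y\<le>Suc n. binom_kernel (Suc n) x y * f y)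
      = (1 - x) * binom_kernel n x 0 * f 0 + (\<Sum>y\<le>n. (x * binom_kernel n x y + (1 - x) * binom_kernel n x (Suc y)) * f (Suc y))"
    by (simp only: sum.atMost_Suc_shift k0) (simp add: kS)
  also have "\<dots> = (1 - x) * (\<Sum>y\<le>Suc n. binom_kernel n x y * f y) + x * (\<Sum>y\<le>n. binom_kernel n x y * f (Suc y))"
    by (simp only: sum.atMost_Suc_shift) (simp add: distrib_left distrib_right sum.distrib sum_distrib_left mult_ac)
  also have "(\<Sum>y\<le>Suc n. binom_kernel n x y * f y) = (\<Sum>y\<le>n. binom_kernel n x y * f y)"
    by (simp add: top)
  finally show ?thesis .
qed

text \<open>Induction by conditioning on the last trial, which shifts the centred variable by
  \<open>-x\<close> or \<open>1 - x\<close>. A shift maps quartics to quartics but mixes their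
  coefficients, so the induction runs over an arbitrary quartic instead of over separate
  moments.\<close>

lemma binom_central_moments:
  "(\<Sum>y\<le>n. binom_kernel n x y * (a + b * (real y - real n * x) + c * (real y - real n * x)\<^sup>2
        + d * (real y - real n * x) ^ 3 + e * (real y - real n * x) ^ 4))
     = a + c * (real n * x * (1 - x)) + d * (real n * x * (1 - x) * (1 - 2 * x))
        + e * (3 * (real n * x * (1 - x))\<^sup>2 + real n * x * (1 - x) * (1 - 6 * x * (1 - x)))"
proof (induction n arbitrary: a b c d e)
  case 0
  then show ?case by (simp add: binom_kernel_def)
next
  case (Suc n)
  let ?P = "\<lambda>a b c d e z::real. a + b * z + c * z\<^sup>2 + d * z ^ 3 + e * z ^ 4"
  have sh: "?P a b c d e (z + h) = ?P (?P a b c d e h) (b + 2 * c * h + 3 * d * h\<^sup>2 + 4 * e * h ^ 3)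
     (c + 3 * d * h + 6 * e * h\<^sup>2) (d + 4 * e * h) e z" for z h
    by (simp add: power2_eq_square power3_eq_cube power4_eq_xxxx algebra_simps)
  have e1: "real y - real (Suc n) * x = (real y - real n * x) + (- x)" for y by (simp add: algebra_simps)
  have e2: "real (Suc y) - real (Suc n) * x = (real y - real n * x) + (1 - x)" for y by (simp add: algebra_simps)
  have S: "real (Suc n) = real n + 1" by simp
  show ?case
    unfolding sum_binom_kernel_Suc e2 unfolding e1 sh Suc.IH unfolding S by algebra
qed

text \<open>Absorption, \<open>(n choose y) / (y + 1) = (Suc n choose Suc y) / Suc n\<close>, turns
  the sum into \<open>1 / (Suc n * x)\<close> times the probability of at least one success in
  \<open>Suc n\<close> trials.\<close>

lemma sum_binom_kernel_inverse_le:
  assumes "0 < x" "x < 1"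
  shows "(\<Sum>y\<le>n. binom_kernel n x y * (1 / (real y + 1))) \<le> 1 / (real (Suc n) * x)"
proof -
  have k: "binom_kernel n x y * (1 / (real y + 1)) = binom_kernel (Suc n) x (Suc y) * (1 / (real (Suc n) * x))" for y
  proof -
    have "real (Suc y) * real (Suc n choose Suc y) = real (Suc n) * real (n choose y)"
      by (simp only: of_nat_mult[symmetric] Suc_times_binomial_eq mult.commute)
    then have "real (n choose y) / (real y + 1) = real (Suc n choose Suc y) / real (Suc n)"
      by (simp add: divide_simps mult_ac add.commute del: binomial_Suc_Suc)
    then have "(real (n choose y) / (real y + 1)) * (x ^ y * (1 - x) ^ (n - y)) = (real (Suc n choose Suc y) / real (Suc n)) * (x ^ y * (1 - x) ^ (n - y))"
      by (rule arg_cong)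
    then show ?thesis using assms by (simp add: binom_kernel_def mult_ac del: binomial_Suc_Suc of_nat_Suc)
  qed
  have "(\<Sum>y\<le>n. binom_kernel (Suc n) x (Suc y)) \<le> 1"
    using sum_binom_kernel[of "Suc n" x] assms by (simp only: sum.atMost_Suc_shift) (smt (verit) binom_kernel_nonneg)
  then have "(\<Sum>y\<le>n. binom_kernel (Suc n) x (Suc y)) * (1 / (real (Suc n) * x)) \<le> 1 * (1 / (real (Suc n) * x))"
    using assms by (intro mult_right_mono) auto
  then show ?thesis by (simp only: k sum_distrib_right mult_1)
qed

lemma binom_kernel_reflect: "y \<le> n \<Longrightarrow> binom_kernel n (1 - x) (n - y) = binom_kernel n x y"
  by (simp add: binom_kernel_def binomial_symmetric[symmetric] mult_ac)

lemma sum_binom_kernel_inverse_le':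
  assumes "0 < x" "x < 1"
  shows "(\<Sum>y\<le>n. binom_kernel n x y * (1 / (real (n - y) + 1))) \<le> 1 / (real (Suc n) * (1 - x))"
proof -
  have "(\<Sum>y\<le>n. binom_kernel n x y * (1 / (real (n - y) + 1))) = (\<Sum>y\<le>n. binom_kernel n (1 - x) y * (1 / (real y + 1)))"
    by (rule sum.reindex_bij_witness[where i = "\<lambda>y. n - y" and j = "\<lambda>y. n - y"]) (auto simp: binom_kernel_reflect)
  then show ?thesis using sum_binom_kernel_inverse_le[of "1 - x" n] assms by simp
qed

text \<open>Terms with a vanishing kernel contribute \<open>0\<close> because of the factor in front of the logarithm.\<close>
definition kernel_div :: "nat \<Rightarrow> real \<Rightarrow> (nat \<Rightarrow> real) \<Rightarrow> real" where
  "kernel_div n x q = (\<Sum>y\<le>n. binom_kernel n x y * ln (binom_kernel n x y / q y))"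

text \<open>An exact form of Stirling's formula: the remainders carry all approximation errors, and
  the last two differences compare the counts \<open>y\<close> and \<open>n - y\<close> with their
  means, ready for \<open>xlogx_bounds\<close>.\<close>

lemma ln_kernel_ref_ratio:
  assumes "0 < x" "x < 1" "y \<le> n" "n \<ge> 1"
  shows "ln (binom_kernel n x y / ref_out n y) = ln pi + stirling_rem n + ln (real n) / 2
      - gamma_half_rem y - gamma_half_rem (n - y)
      - (real y * ln (real y) - real y * ln (real n * x))
      - (real (n - y) * ln (real (n - y)) - real (n - y) * ln (real n * (1 - x)))"
proof -
  have g: "Gamma (real m + 1/2) \<noteq> 0" for m using Gamma_half_pos[of m] by linarith
  have "binom_kernel n x y / ref_out n y
      = pi * fact n * x ^ y * (1 - x) ^ (n - y) / (Gamma (real y + 1/2) * Gamma (real (n - y) + 1/2))"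
    using assms g[of y] g[of "n - y"] by (simp add: binom_kernel_def ref_out_eq binomial_fact)
  also have "ln \<dots> = ln pi + ln (fact n) + real y * ln x + real (n - y) * ln (1 - x)
      - ln (Gamma (real y + 1/2)) - ln (Gamma (real (n - y) + 1/2))"
    using assms g[of y] g[of "n - y"] by (simp add: ln_mult ln_div ln_realpow)
  also have "ln (fact n) = stirling_rem n + (real n + 1/2) * ln (real n) - real n"
    by (simp add: stirling_rem_def)
  finally have 1: "ln (binom_kernel n x y / ref_out n y) = ln pi + (stirling_rem n + (real n + 1/2) * ln (real n) - real n)
      + real y * ln x + real (n - y) * ln (1 - x) - ln (Gamma (real y + 1/2)) - ln (Gamma (real (n - y) + 1/2))" .
  have l: "ln (real n * x) = ln (real n) + ln x" "ln (real n * (1 - x)) = ln (real n) + ln (1 - x)"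
    using assms by (simp_all add: ln_mult)
  have n: "real n = real y + real (n - y)" using assms by simp
  have "(real n + 1/2) * ln (real n) = real y * ln (real n) + real (n - y) * ln (real n) + ln (real n) / 2"
    by (subst (1) n) (simp add: distrib_right del: of_nat_diff)
  then show ?thesis unfolding 1 gamma_half_rem_def l distrib_left using n by linarith
qed

text \<open>The two comparisons with the means are bounded below by deviations that cancel. One of
  \<open>y\<close>, \<open>n - y\<close> is at least \<open>n / 2\<close> and gets the sharp
  remainder, the other only \<open>ln pi / 2\<close>. Hence the bound lies above
  \<open>L / 2\<close> by the constant \<open>(1 + ln 2) / 2\<close>, up to
  \<open>1 / n\<close>.\<close>

lemma ln_kernel_ref_ratio_le:
  assumes "0 < x" "x < 1" "y \<le> n" "n \<ge> 1"
  shows "ln (binom_kernel n x y / ref_out n y) \<le> ln (real n * pi) / 2 + 1 / real n"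
proof -
  have n: "real n \<ge> 1" using assms by simp
  have 1: "real y * ln (real y) - real y * ln (real n * x) \<ge> real y - real n * x"
    using assms by (intro xlogx_bounds) auto
  have 2: "real (n - y) * ln (real (n - y)) - real (n - y) * ln (real n * (1 - x)) \<ge> real (n - y) - real n * (1 - x)"
    using assms by (intro xlogx_bounds) auto
  have 3: "gamma_half_rem y + gamma_half_rem (n - y) \<ge> ln pi / 2 + ln (2 * pi) / 2 - 7/10 / real n"
  proof -
    have *: "gamma_half_rem m \<ge> ln (2 * pi) / 2 - 7/10 / real n" if "n \<le> 2 * m" for m
    proof -
      have "7/20 / (real m + 1) \<le> 7/20 / (real n / 2)"
        using that n by (intro divide_left_mono) auto
      then show ?thesis using gamma_half_rem_ge[of m] by simp
    qed
    show ?thesis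
    proof (cases "n \<le> 2 * y")
      case True
      then show ?thesis using *[of y] gamma_half_rem_ge_0[of "n - y"] by linarith
    next
      case False
      then have "n \<le> 2 * (n - y)" using assms(3) by linarith
      then show ?thesis using *[of "n - y"] gamma_half_rem_ge_0[of y] by linarith
    qed
  qed
  have 4: "stirling_rem n \<le> ln (2 * pi) / 2 + 1 / (4 * real n)" using stirling_rem_bounds(2) assms by simp
  have 5: "ln (real n * pi) = ln (real n) + ln pi" using assms by (simp add: ln_mult)
  have 6: "1 / (4 * real n) + 7/10 / real n \<le> 1 / real n" using n by (simp add: divide_simps)
  have 7: "real y - real n * x + (real (n - y) - real n * (1 - x)) = 0" using assms by (simp add: algebra_simps)
  show ?thesis unfolding ln_kernel_ref_ratio[OF assms] 5 add_divide_distrib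
    using 1 2 3 4 6 7 by linarith
qed

lemma binom_kernel_le_ref_out:
  assumes "0 \<le> x" "x \<le> 1" "y \<le> n" "n \<ge> 1"
  shows "binom_kernel n x y \<le> sqrt (real n * pi) * exp (1 / real n) * ref_out n y"
proof -
  have in01: "binom_kernel n x y \<le> sqrt (real n * pi) * exp (1 / real n) * ref_out n y" if "x \<in> {0<..<1}" for x
  proof -
    have "binom_kernel n x y / ref_out n y > 0"
      using that assms by (intro divide_pos_pos binom_kernel_pos ref_out_pos) auto
    then have "binom_kernel n x y / ref_out n y \<le> exp (ln (real n * pi) / 2 + 1 / real n)"
      using ln_kernel_ref_ratio_le[of x y n] that assms
      by (subst exp_ln[OF \<open>binom_kernel n x y / ref_out n y > 0\<close>, symmetric], subst exp_le_cancel_iff) auto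
    also have "\<dots> = sqrt (real n * pi) * exp (1 / real n)"
      using assms by (simp add: exp_add ln_sqrt[symmetric])
    finally show ?thesis using ref_out_pos[OF assms(3)] by (simp add: divide_le_eq)
  qed
  \<comment> \<open>The logarithmic estimate is confined to interior inputs; continuity in
    \<open>x\<close> carries the product form to both endpoints.\<close>
  have "continuous_on (closure {0<..<1}) (\<lambda>x. binom_kernel n x y)"
    unfolding binom_kernel_def by (intro continuous_intros)
  moreover have "x \<in> closure {0<..<1}" using assms by simp
  ultimately show ?thesis using in01 by (rule continuous_le_on_closure)
qed

lemma kernel_div_eq:
  assumes "\<And>y. y \<le> n \<Longrightarrow> p y > 0" "\<And>y. y \<le> n \<Longrightarrow> q y > 0" "0 \<le> x" "x \<le> 1"
  shows "kernel_div n x q = kernel_div n x p + (\<Sum>y\<le>n. binom_kernel n x y * ln (p y / q y))"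
proof -
  have "binom_kernel n x y * ln (binom_kernel n x y / q y)
      = binom_kernel n x y * ln (binom_kernel n x y / p y) + binom_kernel n x y * ln (p y / q y)" if "y \<le> n" for y
    using assms(1)[OF that] assms(2)[OF that]
    by (cases "binom_kernel n x y = 0") (simp_all add: ln_div algebra_simps)
  then show ?thesis unfolding kernel_div_def by (simp add: sum.distrib[symmetric])
qed

lemma gibbs_inequality:
  fixes p q :: "'a \<Rightarrow> real"
  assumes "finite A" "\<And>y. y \<in> A \<Longrightarrow> p y \<ge> 0" "\<And>y. y \<in> A \<Longrightarrow> q y > 0" "sum q A \<le> sum p A"
  shows "(\<Sum>y\<in>A. p y * ln (p y / q y)) \<ge> 0"
proof -
  have "p y * ln (p y / q y) \<ge> p y - q y" if "y \<in> A" for y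
  proof (cases "p y = 0")
    case True
    then show ?thesis using assms(3)[OF that] by simp
  next
    case False
    then have p: "p y > 0" using assms(2)[OF that] by simp
    then show ?thesis using xlogx_bounds(1)[of "p y" "q y"] assms(3)[OF that]
      by (simp add: ln_div right_diff_distrib)
  qed
  then have "(\<Sum>y\<in>A. p y * ln (p y / q y)) \<ge> (\<Sum>y\<in>A. p y - q y)" by (rule sum_mono)
  then show ?thesis using assms(4) by (simp add: sum_subtractf)
qed

lemma kernel_div_nonneg:
  assumes "\<And>y. y \<le> n \<Longrightarrow> q y > 0" "(\<Sum>y\<le>n. q y) \<le> 1" "0 \<le> x" "x \<le> 1"
  shows "kernel_div n x q \<ge> 0"
  unfolding kernel_div_def using assms by (intro gibbs_inequality) auto

lemma kernel_div_ref_out_le: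
  assumes "0 \<le> x" "x \<le> 1" "n \<ge> 1"
  shows "kernel_div n x (ref_out n) \<le> ln (real n * pi) / 2 + 1 / real n"
proof -
  have "binom_kernel n x y * ln (binom_kernel n x y / ref_out n y)
      \<le> binom_kernel n x y * (ln (real n * pi) / 2 + 1 / real n)" if "y \<le> n" for y
  proof (cases "binom_kernel n x y = 0")
    case False
    then have k: "binom_kernel n x y > 0" using assms binom_kernel_nonneg[of x n y] by linarith
    have r: "ref_out n y > 0" by (rule ref_out_pos[OF that])
    have np: "sqrt (real n * pi) * exp (1 / real n) > 0" using assms by simp
    have "binom_kernel n x y / ref_out n y \<le> sqrt (real n * pi) * exp (1 / real n)"
      using binom_kernel_le_ref_out[OF assms(1,2) that assms(3)] r by (simp add: divide_le_eq)
    then have "ln (binom_kernel n x y / ref_out n y) \<le> ln (sqrt (real n * pi) * exp (1 / real n))"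
      using k r np by (subst ln_le_cancel_iff) auto
    also have "\<dots> = ln (real n * pi) / 2 + 1 / real n" using assms by (simp add: ln_mult ln_sqrt)
    finally show ?thesis using k by (intro mult_left_mono) auto
  qed simp
  then have "kernel_div n x (ref_out n) \<le> (\<Sum>y\<le>n. binom_kernel n x y * (ln (real n * pi) / 2 + 1 / real n))"
    unfolding kernel_div_def by (intro sum_mono) auto
  also have "\<dots> = ln (real n * pi) / 2 + 1 / real n"
    by (simp only: sum_distrib_right[symmetric] sum_binom_kernel mult_1)
  finally show ?thesis .
qed

text \<open>After expansion about the means the linear terms cancel, the quadratic ones average to
  exactly \<open>1/2\<close> (the \<open>e\<close> inside the logarithm), and the cubic ones to
  \<open>(1 - 2 * x)\<^sup>2 / (6 * v)\<close>. In the lower bound all remainders and the cubic mean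
  have the favourable sign, so only the quartic term costs anything.\<close>

lemma
  fixes n :: nat and x :: real
  assumes "0 < x" "x < 1" "n \<ge> 1"
  defines "v \<equiv> real n * x * (1 - x)"
  shows kernel_div_ref_out_upper: "kernel_div n x (ref_out n) \<le> ln (real n * pi / (2 * exp 1)) / 2 + 3/5 / v"
    and kernel_div_ref_out_lower: "v \<ge> 1 \<Longrightarrow> kernel_div n x (ref_out n) \<ge> ln (real n * pi / (2 * exp 1)) / 2 - 12/5 / v"
proof -
  define a where "a = real n * x"
  define b where "b = real n * (1 - x)"
  define z where "z = (\<lambda>y. real y - real n * x)"
  define A where "A = ln pi + stirling_rem n + ln (real n) / 2"
  have n: "real n \<ge> 1" using assms by simp
  have pos: "a > 0" "b > 0" "v > 0" using assms by (auto simp: a_def b_def v_def)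
  have zb: "real (n - y) - b = - z y" if "y \<le> n" for y using that by (simp add: b_def z_def algebra_simps)
  have ab: "v = a * (1 - x)" "v = b * x" by (simp_all add: a_def b_def v_def)
  have L: "ln (real n * pi / (2 * exp 1)) / 2 = ln pi + ln (2 * pi) / 2 + ln (real n) / 2 - ln (2 * pi) - 1/2"
    using n by (simp add: ln_mult ln_div field_simps)
  have ratio: "ln (binom_kernel n x y / ref_out n y) = A - gamma_half_rem y - gamma_half_rem (n - y)
      - (real y * ln (real y) - real y * ln a) - (real (n - y) * ln (real (n - y)) - real (n - y) * ln b)" if "y \<le> n" for y
    unfolding A_def a_def b_def using ln_kernel_ref_ratio[OF assms(1,2) that assms(3)] .
  have k: "binom_kernel n x y \<ge> 0" for y using assms by simp
  have sum_inv: "1 / a + 1 / b = 1 / v"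
    unfolding a_def b_def v_def using assms by (simp add: divide_simps)
  have half: "v / (2 * a) + v / (2 * b) = 1/2"
    unfolding a_def b_def v_def using assms by (simp add: divide_simps) (simp add: algebra_simps)
  have cub: "v * (1 - 2 * x) * (1 / (6 * a\<^sup>2) - 1 / (6 * b\<^sup>2)) = (1 - 2 * x)\<^sup>2 / (6 * v)"
    unfolding a_def b_def v_def using assms by (simp add: divide_simps power2_eq_square) (simp add: algebra_simps)
  have n4v: "1 / (4 * real n) \<le> 1/16 / v"
  proof -
    have "x * (1 - x) \<le> 1/4" using zero_le_power2[of "x - 1/2"] by (simp add: power2_eq_square algebra_simps)
    then have "v \<le> real n * (1/4)" unfolding v_def mult.assoc by (intro mult_left_mono) auto
    then show ?thesis using pos n by (simp add: divide_simps)
  qed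
  show "kernel_div n x (ref_out n) \<le> ln (real n * pi / (2 * exp 1)) / 2 + 3/5 / v"
  proof -
    have pt: "ln (binom_kernel n x y / ref_out n y) \<le>
        (A - ln (2 * pi) + 0 * (real y - real n * x) + (- (1 / (2 * a) + 1 / (2 * b))) * (real y - real n * x)\<^sup>2
         + (1 / (6 * a\<^sup>2) - 1 / (6 * b\<^sup>2)) * (real y - real n * x) ^ 3 + 0 * (real y - real n * x) ^ 4)
         + (7/20 * (1 / (real y + 1)) + 7/20 * (1 / (real (n - y) + 1)))" if "y \<le> n" for y
    proof -
      have 1: "real y * ln (real y) - real y * ln a \<ge> z y + (z y)\<^sup>2 / (2 * a) - (z y) ^ 3 / (6 * a\<^sup>2)"
        using xlogx_bounds(2)[of "real y" a] pos by (simp add: z_def a_def)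
      have 2: "real (n - y) * ln (real (n - y)) - real (n - y) * ln b \<ge> - z y + (z y)\<^sup>2 / (2 * b) + (z y) ^ 3 / (6 * b\<^sup>2)"
        using xlogx_bounds(2)[of "real (n - y)" b] pos unfolding zb[OF that] by simp
      show ?thesis unfolding ratio[OF that]
        using 1 2 gamma_half_rem_ge[of y] gamma_half_rem_ge[of "n - y"] unfolding z_def
        by (simp add: algebra_simps)
    qed
    have "kernel_div n x (ref_out n) \<le> (\<Sum>y\<le>n. binom_kernel n x y * ((A - ln (2 * pi) + 0 * (real y - real n * x) + (- (1 / (2 * a) + 1 / (2 * b))) * (real y - real n * x)\<^sup>2
         + (1 / (6 * a\<^sup>2) - 1 / (6 * b\<^sup>2)) * (real y - real n * x) ^ 3 + 0 * (real y - real n * x) ^ 4)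
         + (7/20 * (1 / (real y + 1)) + 7/20 * (1 / (real (n - y) + 1)))))"
      unfolding kernel_div_def by (intro sum_mono mult_left_mono pt k) auto
    also have "\<dots> = (A - ln (2 * pi) - (v / (2 * a) + v / (2 * b)) + v * (1 - 2 * x) * (1 / (6 * a\<^sup>2) - 1 / (6 * b\<^sup>2)))
        + 7/20 * (\<Sum>y\<le>n. binom_kernel n x y * (1 / (real y + 1))) + 7/20 * (\<Sum>y\<le>n. binom_kernel n x y * (1 / (real (n - y) + 1)))"
    proof -
      have sp: "(\<Sum>y\<le>n. binom_kernel n x y * (f y + (7/20 * g y + 7/20 * h y)))
         = (\<Sum>y\<le>n. binom_kernel n x y * f y) + 7/20 * (\<Sum>y\<le>n. binom_kernel n x y * g y) + 7/20 * (\<Sum>y\<le>n. binom_kernel n x y * h y)" for f g h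
        by (simp add: distrib_left sum.distrib sum_distrib_left sum_divide_distrib mult_ac)
      show ?thesis
        by (subst sp, subst binom_central_moments) (simp only: v_def[symmetric], simp add: algebra_simps)
    qed
    also have "\<dots> \<le> (A - ln (2 * pi) - 1/2 + 1 / (6 * v)) + 7/20 * (1 / a) + 7/20 * (1 / b)"
    proof -
      have "(1 - 2 * x)\<^sup>2 \<le> 1" using assms by (simp add: abs_square_le_1 abs_if)
      then have c: "(1 - 2 * x)\<^sup>2 / (6 * v) \<le> 1 / (6 * v)" using pos by (intro divide_right_mono) auto
      have "1 / (real (Suc n) * x) \<le> 1 / a" "1 / (real (Suc n) * (1 - x)) \<le> 1 / b"
        unfolding a_def b_def using assms by (auto intro!: divide_left_mono mult_right_mono mult_pos_pos)
      then show ?thesis unfolding half cub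
        using sum_binom_kernel_inverse_le[OF assms(1,2), of n] sum_binom_kernel_inverse_le'[OF assms(1,2), of n] c
        by linarith
    qed
    also have "\<dots> = A - ln (2 * pi) - 1/2 + 1 / (6 * v) + 7/20 / v"
      using sum_inv by simp
    also have "\<dots> \<le> ln (real n * pi / (2 * exp 1)) / 2 + 3/5 / v"
    proof -
      \<comment> \<open>Contributions of the cubic mean, the Gamma remainders and the Stirling
        remainder of \<open>n\<close>.\<close>
      have "1 / (6 * v) + 7/20 / v + 1/16 / v \<le> 3/5 / v" using pos by (simp add: divide_simps)
      then show ?thesis unfolding L A_def using stirling_rem_bounds(2)[OF assms(3)] n4v by linarith
    qed
    finally show ?thesis .
  qed
  show "kernel_div n x (ref_out n) \<ge> ln (real n * pi / (2 * exp 1)) / 2 - 12/5 / v" if v1: "v \<ge> 1"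
  proof -
    have pt: "ln (binom_kernel n x y / ref_out n y) \<ge>
        A - ln (2 * pi) + 0 * (real y - real n * x) + (- (1 / (2 * a) + 1 / (2 * b))) * (real y - real n * x)\<^sup>2
         + (1 / (6 * a\<^sup>2) - 1 / (6 * b\<^sup>2)) * (real y - real n * x) ^ 3
         + (- (3/5 * (1 / a ^ 3 + 1 / b ^ 3))) * (real y - real n * x) ^ 4" if "y \<le> n" for y
    proof -
      have 1: "real y * ln (real y) - real y * ln a \<le> z y + (z y)\<^sup>2 / (2 * a) - (z y) ^ 3 / (6 * a\<^sup>2) + 3/5 * ((z y) ^ 4 / a ^ 3)"
        using xlogx_bounds(3)[of "real y" a] pos by (simp add: z_def a_def)
      have 2: "real (n - y) * ln (real (n - y)) - real (n - y) * ln b \<le> - z y + (z y)\<^sup>2 / (2 * b) + (z y) ^ 3 / (6 * b\<^sup>2) + 3/5 * ((z y) ^ 4 / b ^ 3)"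
        using xlogx_bounds(3)[of "real (n - y)" b] pos unfolding zb[OF that] by simp
      show ?thesis unfolding ratio[OF that]
        using 1 2 gamma_half_rem_le[of y] gamma_half_rem_le[of "n - y"] unfolding z_def
        by (simp add: algebra_simps)
    qed
    \<comment> \<open>The hypothesis \<open>v \<ge> 1\<close> absorbs the linear part of the fourth
      moment into \<open>v\<^sup>2\<close>. Together with \<open>inv3\<close> the quartic loss is at
      most \<open>3/5 * 4 / v\<close>, the source of \<open>12/5\<close>.\<close>
    have m4: "3 * v\<^sup>2 + v * (1 - 6 * x * (1 - x)) \<le> 4 * v\<^sup>2"
    proof -
      have "v * (1 - 6 * x * (1 - x)) \<le> v * v" using pos v1 assms by (intro mult_left_mono) (auto intro: order.trans[of _ 1])
      then show ?thesis by (simp add: power2_eq_square)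
    qed
    have inv3: "v\<^sup>2 * (1 / a ^ 3 + 1 / b ^ 3) \<le> 1 / v"
    proof -
      have "v ^ 3 * (1 / a ^ 3 + 1 / b ^ 3) = (1 - x) ^ 3 + x ^ 3"
      proof -
        have "v ^ 3 / a ^ 3 = (1 - x) ^ 3" using pos by (simp add: ab(1) power_mult_distrib)
        moreover have "v ^ 3 / b ^ 3 = x ^ 3" using pos by (simp add: ab(2) power_mult_distrib)
        ultimately show ?thesis by (simp add: distrib_left)
      qed
      also have "\<dots> = 1 - 3 * (x * (1 - x))" by (simp add: power3_eq_cube algebra_simps)
      also have "\<dots> \<le> 1" using assms by simp
      finally show ?thesis using pos by (simp add: field_simps power3_eq_cube power2_eq_square)
    qed
    have "ln (real n * pi / (2 * exp 1)) / 2 - 12/5 / v \<le> A - ln (2 * pi) - 1/2 - 12/5 * (1 / v)"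
      unfolding L A_def using stirling_rem_bounds(1)[OF assms(3)] by simp
    also have "\<dots> \<le> A - ln (2 * pi) - (v / (2 * a) + v / (2 * b)) + v * (1 - 2 * x) * (1 / (6 * a\<^sup>2) - 1 / (6 * b\<^sup>2))
        - 3/5 * ((1 / a ^ 3 + 1 / b ^ 3) * (3 * v\<^sup>2 + v * (1 - 6 * x * (1 - x))))"
    proof -
      have "(1 / a ^ 3 + 1 / b ^ 3) * (3 * v\<^sup>2 + v * (1 - 6 * x * (1 - x))) \<le> (1 / a ^ 3 + 1 / b ^ 3) * (4 * v\<^sup>2)"
        using pos by (intro mult_left_mono m4) auto
      also have "\<dots> \<le> 4 * (1 / v)" using inv3 by (simp add: algebra_simps)
      finally have "(1 / a ^ 3 + 1 / b ^ 3) * (3 * v\<^sup>2 + v * (1 - 6 * x * (1 - x))) \<le> 4 * (1 / v)" .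
      moreover have "(1 - 2 * x)\<^sup>2 / (6 * v) \<ge> 0" using pos by simp
      ultimately show ?thesis unfolding half cub by linarith
    qed
    also have "\<dots> = (\<Sum>y\<le>n. binom_kernel n x y * (A - ln (2 * pi) + 0 * (real y - real n * x) + (- (1 / (2 * a) + 1 / (2 * b))) * (real y - real n * x)\<^sup>2
         + (1 / (6 * a\<^sup>2) - 1 / (6 * b\<^sup>2)) * (real y - real n * x) ^ 3
         + (- (3/5 * (1 / a ^ 3 + 1 / b ^ 3))) * (real y - real n * x) ^ 4))"
      by (subst binom_central_moments) (simp only: v_def[symmetric], simp add: algebra_simps)
    also have "\<dots> \<le> kernel_div n x (ref_out n)"
      unfolding kernel_div_def by (intro sum_mono mult_left_mono pt k) auto
    finally show ?thesis .
  qed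
qed

subsection \<open>Optimality conditions for the capacity-achieving input\<close>

lemma borel_measurable_binom_kernel [measurable]: "(\<lambda>x. binom_kernel n x y) \<in> borel_measurable borel"
  unfolding binom_kernel_def by measurable

lemma borel_measurable_kernel_div [measurable]: "(\<lambda>x. kernel_div n x q) \<in> borel_measurable borel"
  unfolding kernel_div_def by measurable

lemma input_dist_AE:
  assumes "input_dist M" shows "AE x in M. x \<in> {0..1}"
proof -
  interpret prob_space M using assms by (simp add: input_dist_def)
  have "{0..1::real} \<in> sets M" using assms by (simp add: input_dist_def)
  moreover have "prob {0..1} = 1" using assms by (simp add: input_dist_def measure_def)
  ultimately show ?thesis using prob_eq_1 by blast
qed

lemma input_dist_integrable:
  fixes f :: "real \<Rightarrow> real"
  assumes "input_dist M" "f \<in> borel_measurable borel" "\<And>x. 0 \<le> x \<Longrightarrow> x \<le> 1 \<Longrightarrow> \<bar>f x\<bar> \<le> B"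
  shows "integrable M f"
proof -
  interpret prob_space M using assms by (simp add: input_dist_def)
  have "sets M = sets borel" using assms(1) by (simp add: input_dist_def)
  then have "f \<in> borel_measurable M" using assms(2) by (simp cong: measurable_cong_sets)
  then show ?thesis
    using input_dist_AE[OF assms(1)] assms(3)
    by (intro integrable_const_bound[where B = B]) auto
qed

lemma input_dist_integral_mono:
  fixes f g :: "real \<Rightarrow> real"
  assumes "input_dist M" "integrable M f" "integrable M g" "\<And>x. 0 \<le> x \<Longrightarrow> x \<le> 1 \<Longrightarrow> f x \<le> g x"
  shows "(\<integral>x. f x \<partial>M) \<le> (\<integral>x. g x \<partial>M)"
  using input_dist_AE[OF assms(1)] assms by (intro integral_mono_AE) auto

lemma integrable_binom_kernel:
  assumes "input_dist M" "y \<le> n" shows "integrable M (\<lambda>x. binom_kernel n x y)"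
  by (rule input_dist_integrable[OF assms(1), where B = 1]) (use assms(2) in \<open>auto simp: binom_kernel_le_1\<close>)

lemma out_dist_nonneg: "input_dist M \<Longrightarrow> out_dist n M y \<ge> 0"
  unfolding out_dist_def using input_dist_AE[of M] by (intro integral_nonneg_AE) auto

lemma sum_out_dist:
  assumes "input_dist M" shows "(\<Sum>y\<le>n. out_dist n M y) = 1"
proof -
  interpret prob_space M using assms by (simp add: input_dist_def)
  have "(\<Sum>y\<le>n. out_dist n M y) = (\<integral>x. (\<Sum>y\<le>n. binom_kernel n x y) \<partial>M)"
    unfolding out_dist_def using assms by (intro Bochner_Integration.integral_sum[symmetric] integrable_binom_kernel) auto
  then show ?thesis using prob_space by simp
qed

lemma out_dist_le_1:
  assumes "input_dist M" "y \<le> n" shows "out_dist n M y \<le> 1"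
  using member_le_sum[of y "{..n}" "out_dist n M"] assms by (simp add: sum_out_dist out_dist_nonneg)

text \<open>Negative entropy of the output given the input \<open>x\<close>. Its integral is the
  part of the mutual information that is linear in the input law; the remaining part depends on the
  output law alone.\<close>

definition kernel_negent :: "nat \<Rightarrow> real \<Rightarrow> real" where
  "kernel_negent n x = (\<Sum>y\<le>n. binom_kernel n x y * ln (binom_kernel n x y))"

lemma borel_measurable_kernel_negent [measurable]: "kernel_negent n \<in> borel_measurable borel"
  unfolding kernel_negent_def by measurable

lemma abs_kernel_negent_le:
  assumes "0 \<le> x" "x \<le> 1" shows "\<bar>kernel_negent n x\<bar> \<le> real n + 1"
proof -
  have "\<bar>binom_kernel n x y * ln (binom_kernel n x y)\<bar> \<le> 1" if "y \<le> n" for y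
  proof -
    let ?k = "binom_kernel n x y"
    have k: "0 \<le> ?k" "?k \<le> 1" using assms that by (auto simp: binom_kernel_le_1)
    then have "?k * ln ?k \<ge> -1" using xlogx_bounds(1)[of ?k 1] by simp
    moreover have "?k * ln ?k \<le> 0"
      using k by (cases "?k = 0") (auto intro!: mult_nonneg_nonpos)
    ultimately show ?thesis by simp
  qed
  then have "(\<Sum>y\<le>n. \<bar>binom_kernel n x y * ln (binom_kernel n x y)\<bar>) \<le> (\<Sum>y\<le>n. 1)"
    by (intro sum_mono) auto
  then show ?thesis unfolding kernel_negent_def
    by (intro order.trans[OF sum_abs]) simp
qed

lemma integrable_kernel_negent: "input_dist M \<Longrightarrow> integrable M (kernel_negent n)"
  by (rule input_dist_integrable[where B = "real n + 1"]) (auto intro: abs_kernel_negent_le)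

lemma kernel_div_negent:
  assumes "\<And>y. y \<le> n \<Longrightarrow> q y > 0"
  shows "kernel_div n x q = kernel_negent n x - (\<Sum>y\<le>n. binom_kernel n x y * ln (q y))"
proof -
  have "binom_kernel n x y * ln (binom_kernel n x y / q y)
      = binom_kernel n x y * ln (binom_kernel n x y) - binom_kernel n x y * ln (q y)" if "y \<le> n" for y
    using assms[OF that] by (cases "binom_kernel n x y = 0") (auto simp: ln_div right_diff_distrib)
  then show ?thesis unfolding kernel_div_def kernel_negent_def by (simp add: sum_subtractf)
qed

lemma integral_sum_binom_kernel:
  assumes "input_dist M"
  shows "integrable M (\<lambda>x. \<Sum>y\<le>n. binom_kernel n x y * c y)"
    and "(\<integral>x. (\<Sum>y\<le>n. binom_kernel n x y * c y) \<partial>M) = (\<Sum>y\<le>n. out_dist n M y * c y)"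
proof -
  have i: "integrable M (\<lambda>x. binom_kernel n x y * c y)" if "y \<le> n" for y
    using integrable_binom_kernel[OF assms that] by simp
  then show "integrable M (\<lambda>x. \<Sum>y\<le>n. binom_kernel n x y * c y)" by auto
  have "(\<integral>x. (\<Sum>y\<le>n. binom_kernel n x y * c y) \<partial>M) = (\<Sum>y\<le>n. \<integral>x. binom_kernel n x y * c y \<partial>M)"
    using i by (intro Bochner_Integration.integral_sum) auto
  then show "(\<integral>x. (\<Sum>y\<le>n. binom_kernel n x y * c y) \<partial>M) = (\<Sum>y\<le>n. out_dist n M y * c y)"
    by (simp add: out_dist_def)
qed

lemma integrable_kernel_div:
  assumes "input_dist M" "\<And>y. y \<le> n \<Longrightarrow> q y > 0"
  shows "integrable M (\<lambda>x. kernel_div n x q)"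
    and "(\<integral>x. kernel_div n x q \<partial>M) = (\<integral>x. kernel_negent n x \<partial>M) - (\<Sum>y\<le>n. out_dist n M y * ln (q y))"
proof -
  have eq: "(\<lambda>x. kernel_div n x q) = (\<lambda>x. kernel_negent n x - (\<Sum>y\<le>n. binom_kernel n x y * ln (q y)))"
    by (rule ext, rule kernel_div_negent) (rule assms(2))
  show "integrable M (\<lambda>x. kernel_div n x q)"
    and "(\<integral>x. kernel_div n x q \<partial>M) = (\<integral>x. kernel_negent n x \<partial>M) - (\<Sum>y\<le>n. out_dist n M y * ln (q y))"
    unfolding eq
    using integrable_kernel_negent[OF assms(1), of n] integral_sum_binom_kernel[OF assms(1), of n "\<lambda>y. ln (q y)"]
    by auto
qed

lemma mutual_info_eq:
  assumes "input_dist M"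
  shows "mutual_info n M = (\<integral>x. kernel_negent n x \<partial>M) - (\<Sum>y\<le>n. out_dist n M y * ln (out_dist n M y))"
proof -
  interpret prob_space M using assms by (simp add: input_dist_def)
  have zero: "AE x in M. out_dist n M y = 0 \<longrightarrow> binom_kernel n x y = 0" if "y \<le> n" for y
  proof (cases "out_dist n M y = 0")
    case True
    have "AE x in M. 0 \<le> binom_kernel n x y" using input_dist_AE[OF assms] by auto
    then have "AE x in M. binom_kernel n x y = 0"
      using True integral_nonneg_eq_0_iff_AE[OF integrable_binom_kernel[OF assms that]] by (simp add: out_dist_def)
    then show ?thesis by auto
  qed simp
  then have "AE x in M. \<forall>y\<in>{..n}. out_dist n M y = 0 \<longrightarrow> binom_kernel n x y = 0"
    by (intro AE_finite_allI) auto
  then have "AE x in M. (\<Sum>y\<le>n. if binom_kernel n x y = 0 then 0 else binom_kernel n x y * ln (binom_kernel n x y / out_dist n M y))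
      = kernel_negent n x - (\<Sum>y\<le>n. binom_kernel n x y * ln (out_dist n M y))"
  proof eventually_elim
    case (elim x)
    have "(if binom_kernel n x y = 0 then 0 else binom_kernel n x y * ln (binom_kernel n x y / out_dist n M y))
       = binom_kernel n x y * ln (binom_kernel n x y) - binom_kernel n x y * ln (out_dist n M y)" if "y \<le> n" for y
      using elim that by (auto simp: ln_div right_diff_distrib)
    then show ?case unfolding kernel_negent_def by (simp add: sum_subtractf)
  qed
  then have "mutual_info n M = (\<integral>x. kernel_negent n x - (\<Sum>y\<le>n. binom_kernel n x y * ln (out_dist n M y)) \<partial>M)"
    unfolding mutual_info_def
    using assms by (intro integral_cong_AE) (auto simp: input_dist_def cong: measurable_cong_sets)
  then show ?thesis
    using integrable_kernel_negent[OF assms, of n] integral_sum_binom_kernel[OF assms, of n] by simp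
qed

text \<open>The mixture is the law of a two-stage draw: a Bernoulli variable with parameter
  \<open>t\<close> decides between the fixed point \<open>x0\<close> and a sample from
  \<open>M\<close>. Fubini then splits every integral.\<close>

lemma input_dist_mix:
  assumes "input_dist M" "0 \<le> x0" "x0 \<le> 1" "0 \<le> t" "t \<le> 1"
  obtains N where "input_dist N"
    and "\<And>f :: real \<Rightarrow> real. f \<in> borel_measurable borel \<Longrightarrow> integrable N f \<Longrightarrow>
           (\<integral>x. f x \<partial>N) = t * f x0 + (1 - t) * (\<integral>x. f x \<partial>M)"
proof
  interpret M: prob_space M using assms by (simp add: input_dist_def)
  have sM: "sets M = sets borel" using assms by (simp add: input_dist_def)
  let ?B = "measure_pmf (bernoulli_pmf t)"
  let ?g = "\<lambda>(b, x). if b then x0 else x"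
  let ?N = "distr (?B \<Otimes>\<^sub>M M) borel ?g"
  interpret P: pair_prob_space ?B M ..
  have g: "?g \<in> borel_measurable (?B \<Otimes>\<^sub>M M)"
  proof -
    have "?g \<in> borel_measurable (count_space UNIV \<Otimes>\<^sub>M borel)" by measurable
    then show ?thesis using sM by (simp cong: measurable_cong_sets sets_pair_measure_cong)
  qed
  interpret N: prob_space ?N by (rule P.prob_space_distr[OF g])
  have AE: "AE z in ?B \<Otimes>\<^sub>M M. ?g z \<in> {0..1}"
  proof (rule P.AE_pair_measure)
    show "{z \<in> space (?B \<Otimes>\<^sub>M M). ?g z \<in> {0..1}} \<in> sets (?B \<Otimes>\<^sub>M M)" using g by measurable
    show "AE b in ?B. AE x in M. ?g (b, x) \<in> {0..1}"
      using input_dist_AE[OF assms(1)] assms(2,3) by auto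
  qed
  have "AE x in ?N. x \<in> {0..1}"
    using AE by (subst AE_distr_iff[OF g]) auto
  then have "emeasure ?N {0..1} = 1"
    by (subst N.emeasure_eq_1_AE) auto
  then show "input_dist ?N"
    by (simp add: input_dist_def N.prob_space_axioms)
  fix f :: "real \<Rightarrow> real"
  assume f: "f \<in> borel_measurable borel" and i: "integrable ?N f"
  have "(\<integral>x. f x \<partial>?N) = (\<integral>z. f (?g z) \<partial>(?B \<Otimes>\<^sub>M M))"
    by (rule integral_distr[OF g f])
  also have "\<dots> = (\<integral>b. \<integral>x. f (?g (b, x)) \<partial>M \<partial>?B)"
    using i integrable_distr_eq[OF g f] by (intro P.integral_fst'[symmetric]) auto
  also have "\<dots> = t * f x0 + (1 - t) * (\<integral>x. f x \<partial>M)"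
    using assms(4,5) M.prob_space by (simp add: mult.commute)
  finally show "(\<integral>x. f x \<partial>?N) = t * f x0 + (1 - t) * (\<integral>x. f x \<partial>M)" .
qed

text \<open>Moving mass \<open>t\<close> to the point \<open>x\<close> cannot increase the mutual information; convexity of
  \<open>q * ln q\<close> turns this into an inequality that is linear in \<open>t\<close>.\<close>
lemma capacity_perturb:
  assumes "capacity_achieving n M" "0 \<le> x" "x \<le> 1" "0 < t" "t < 1"
    and pos: "\<And>y. y \<le> n \<Longrightarrow> t * binom_kernel n x y + (1 - t) * out_dist n M y > 0"
  shows "kernel_negent n x - (\<integral>x. kernel_negent n x \<partial>M)
      \<le> (\<Sum>y\<le>n. (binom_kernel n x y - out_dist n M y) * ln (t * binom_kernel n x y + (1 - t) * out_dist n M y))"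
proof -
  have M: "input_dist M" using assms by (simp add: capacity_achieving_def)
  obtain N where N: "input_dist N"
    and int: "\<And>f :: real \<Rightarrow> real. f \<in> borel_measurable borel \<Longrightarrow> integrable N f \<Longrightarrow>
           (\<integral>x. f x \<partial>N) = t * f x + (1 - t) * (\<integral>x. f x \<partial>M)"
    using input_dist_mix[OF M assms(2,3), of t] assms(4,5) by (metis less_imp_le)
  let ?Q = "out_dist n M" and ?k = "binom_kernel n x" and ?h = "\<integral>x. kernel_negent n x \<partial>M"
  define q where "q y = t * ?k y + (1 - t) * ?Q y" for y
  have QN: "out_dist n N y = q y" if "y \<le> n" for y
    unfolding out_dist_def q_def using int[of "\<lambda>x. binom_kernel n x y"] integrable_binom_kernel[OF N that] by simp
  have "mutual_info n N \<le> mutual_info n M" using assms(1) N by (simp add: capacity_achieving_def)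
  moreover have "mutual_info n N = t * kernel_negent n x + (1 - t) * ?h - (\<Sum>y\<le>n. q y * ln (q y))"
    unfolding mutual_info_eq[OF N] using int[of "kernel_negent n"] integrable_kernel_negent[OF N] QN by simp
  ultimately have "t * (kernel_negent n x - ?h) \<le> (\<Sum>y\<le>n. q y * ln (q y)) - (\<Sum>y\<le>n. ?Q y * ln (?Q y))"
    unfolding mutual_info_eq[OF M] by (simp add: algebra_simps)
  also have "\<dots> \<le> (\<Sum>y\<le>n. (q y - ?Q y) * ln (q y) + (q y - ?Q y))"
    unfolding sum_subtractf[symmetric]
  proof (rule sum_mono)
    fix y assume "y \<in> {..n}"
    then have "?Q y * ln (?Q y) - ?Q y * ln (q y) \<ge> ?Q y - q y"
      using pos[of y] out_dist_nonneg[OF M] by (intro xlogx_bounds) (auto simp: q_def)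
    then show "q y * ln (q y) - ?Q y * ln (?Q y) \<le> (q y - ?Q y) * ln (q y) + (q y - ?Q y)"
      by (simp add: algebra_simps)
  qed
  also have "\<dots> = (\<Sum>y\<le>n. t * ((?k y - ?Q y) * ln (q y)))"
  proof -
    have d: "q y - ?Q y = t * (?k y - ?Q y)" for y by (simp add: q_def algebra_simps)
    have "(\<Sum>y\<le>n. q y - ?Q y) = t * ((\<Sum>y\<le>n. ?k y) - (\<Sum>y\<le>n. ?Q y))"
      unfolding d sum_distrib_left[symmetric] sum_subtractf ..
    then have "(\<Sum>y\<le>n. q y - ?Q y) = 0" using sum_out_dist[OF M, of n] by simp
    then show ?thesis by (simp add: sum.distrib) (simp add: d mult_ac)
  qed
  finally have "t * (kernel_negent n x - ?h) \<le> t * (\<Sum>y\<le>n. (?k y - ?Q y) * ln (q y))"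
    by (simp only: sum_distrib_left)
  then show ?thesis using assms(4) unfolding q_def by (simp only: mult_le_cancel_left_pos)
qed

text \<open>If an output had probability \<open>0\<close>, perturbing towards \<open>x = 1/2\<close> would gain a term of order
  \<open>- t * ln t\<close>.\<close>
lemma capacity_out_dist_pos:
  assumes "capacity_achieving n M" "y \<le> n"
  shows "out_dist n M y > 0"
proof (rule ccontr)
  assume "\<not> ?thesis"
  have M: "input_dist M" using assms by (simp add: capacity_achieving_def)
  let ?Q = "out_dist n M" and ?k = "binom_kernel n (1/2)" and ?h = "\<integral>x. kernel_negent n x \<partial>M"
  have Q: "0 \<le> ?Q z" "z \<le> n \<Longrightarrow> ?Q z \<le> 1" for z using out_dist_nonneg[OF M] out_dist_le_1[OF M] by auto
  have k: "0 < ?k z" "?k z \<le> 1" if "z \<le> n" for z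
    using that by (auto intro: binom_kernel_pos binom_kernel_le_1)
  from \<open>\<not> ?thesis\<close> Q have Qy: "?Q y = 0" by (metis order_le_less)
  \<comment> \<open>For \<open>t \<le> 1/2\<close> the mixed output is at least half of
    \<open>?Q z\<close>, so \<open>c z\<close> bounds the term of \<open>z\<close> uniformly in
    \<open>t\<close>. Where \<open>?Q z = 0\<close> the term is at most \<open>?k z * ln t\<close>,
    hence nonpositive.\<close>
  define c where "c z = (if ?Q z = 0 then 0 else - ln (?Q z / 2))" for z
  have cnn: "c z \<ge> 0" if "z \<le> n" for z
    unfolding c_def using Q[of z] that by (auto simp: ln_le_zero_iff)
  define K where "K = (\<Sum>z\<le>n. c z) - (kernel_negent n (1/2) - ?h)"
  have bound: "kernel_negent n (1/2) - ?h \<le> (\<Sum>z\<le>n. c z) + ?k y * ln t" if t: "0 < t" "t \<le> 1/2" for t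
  proof -
    let ?q = "\<lambda>z. t * ?k z + (1 - t) * ?Q z"
    have qpos: "?q z > 0" if "z \<le> n" for z
      using t k[OF that] Q[of z] by (intro add_pos_nonneg) auto
    have q1: "?q z \<le> 1" if "z \<le> n" for z
      using t k[OF that] Q[of z] that convex_bound_le[of "?k z" 1 "?Q z" t "1 - t"] by auto
    have pt: "(?k z - ?Q z) * ln (?q z) \<le> c z + (if z = y then ?k y * ln t else 0)" if "z \<le> n" for z
    proof (cases "?Q z = 0")
      case True
      have "?k z * ln (t * ?k z) \<le> ?k z * ln t"
        using t k[OF that] by (intro mult_left_mono) (auto simp: mult_le_cancel_left1 mult_le_one)
      moreover have "?k z * ln t \<le> 0" using t k[OF that] by (intro mult_nonneg_nonpos) auto
      ultimately show ?thesis using True by (auto simp: c_def)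
    next
      case False
      then have Qz: "?Q z > 0" using Q(1)[of z] by simp
      have "?Q z / 2 \<le> (1 - t) * ?Q z"
        using mult_right_mono[of "1/2" "1 - t" "?Q z"] t Qz by simp
      then have "?Q z / 2 \<le> ?q z" using t k[OF that] by (simp add: add_increasing)
      then have l: "ln (?Q z / 2) \<le> ln (?q z)" using Qz qpos[OF that] by (subst ln_le_cancel_iff) auto
      have l0: "ln (?q z) \<le> 0" using q1[OF that] qpos[OF that] by simp
      have "(?k z - ?Q z) * ln (?q z) \<le> \<bar>?k z - ?Q z\<bar> * \<bar>ln (?q z)\<bar>" by (metis abs_ge_self abs_mult)
      also have "\<dots> \<le> 1 * \<bar>ln (?q z)\<bar>"
        using k[OF that] Q[of z] that by (intro mult_right_mono) (auto simp: abs_le_iff)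
      also have "\<dots> \<le> c z" using l l0 False by (simp add: c_def)
      finally show ?thesis using False Qy by auto
    qed
    have "kernel_negent n (1/2) - ?h \<le> (\<Sum>z\<le>n. (?k z - ?Q z) * ln (?q z))"
      using t qpos by (intro capacity_perturb[OF assms(1)]) auto
    also have "\<dots> \<le> (\<Sum>z\<le>n. c z + (if z = y then ?k y * ln t else 0))"
      by (intro sum_mono pt) auto
    also have "\<dots> = (\<Sum>z\<le>n. c z) + ?k y * ln t" using assms(2) by (simp add: sum.distrib)
    finally show ?thesis .
  qed
  \<comment> \<open>With \<open>t = exp (- s)\<close> the gain is \<open>?k y * s\<close>, made
    larger than the fixed bound \<open>K\<close>; the maximum with \<open>1\<close> keeps
    \<open>t \<le> 1/2\<close>.\<close>
  define s where "s = max 1 ((K + 1) / ?k y)"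
  have "exp (- s) \<le> exp (- 1 :: real)" by (simp add: s_def)
  also have "\<dots> \<le> 1/2" using exp_ge_add_one_self[of 1] by (simp add: exp_minus field_simps)
  finally have "kernel_negent n (1/2) - ?h \<le> (\<Sum>z\<le>n. c z) + ?k y * ln (exp (- s))"
    by (intro bound) auto
  then have "?k y * s \<le> K" by (simp add: K_def)
  moreover have "?k y * s \<ge> K + 1"
  proof -
    have "s \<ge> (K + 1) / ?k y" by (simp add: s_def)
    then show ?thesis using k(1)[OF assms(2)] by (simp add: divide_le_eq mult.commute)
  qed
  ultimately show False by simp
qed

text \<open>The limit of \<open>capacity_perturb\<close> as \<open>t\<close> tends to
  \<open>0\<close> from the right. Positivity of the output law had to come first because it makes
  the logarithms continuous at the limit.\<close>

lemma capacity_kkt: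
  assumes "capacity_achieving n M" "0 \<le> x" "x \<le> 1"
  shows "kernel_div n x (out_dist n M) \<le> mutual_info n M"
proof -
  have M: "input_dist M" using assms by (simp add: capacity_achieving_def)
  let ?Q = "out_dist n M" and ?k = "binom_kernel n x" and ?h = "\<integral>x. kernel_negent n x \<partial>M"
  have Q: "?Q y > 0" if "y \<le> n" for y using capacity_out_dist_pos[OF assms(1) that] .
  let ?f = "\<lambda>t. \<Sum>y\<le>n. (?k y - ?Q y) * ln (t * ?k y + (1 - t) * ?Q y)"
  have "(?f \<longlongrightarrow> (\<Sum>y\<le>n. (?k y - ?Q y) * ln (0 * ?k y + (1 - 0) * ?Q y))) (at_right 0)"
    using Q by (intro tendsto_intros) (auto simp: less_imp_neq[symmetric])
  moreover have "\<forall>\<^sub>F t in at_right 0. kernel_negent n x - ?h \<le> ?f t"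
    using eventually_at_right_less[of "0::real"] eventually_at_right_real[of 0 "1::real", OF zero_less_one]
  proof eventually_elim
    case (elim t)
    then show ?case using Q assms(2,3) by (intro capacity_perturb[OF assms]) (auto intro!: add_nonneg_pos)
  qed
  ultimately have "kernel_negent n x - ?h \<le> (\<Sum>y\<le>n. (?k y - ?Q y) * ln (0 * ?k y + (1 - 0) * ?Q y))"
    by (rule tendsto_lowerbound) simp
  then have "kernel_negent n x - ?h \<le> (\<Sum>y\<le>n. ?k y * ln (?Q y)) - (\<Sum>y\<le>n. ?Q y * ln (?Q y))"
    by (simp add: left_diff_distrib sum_subtractf)
  then show ?thesis
    unfolding mutual_info_eq[OF M] using kernel_div_negent[of n ?Q x] Q by simp
qed

lemma mutual_info_eq_integral_kernel_div:
  assumes "capacity_achieving n M"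
  shows "(\<integral>x. kernel_div n x (out_dist n M) \<partial>M) = mutual_info n M"
proof -
  have M: "input_dist M" using assms by (simp add: capacity_achieving_def)
  show ?thesis
    using integrable_kernel_div(2)[OF M, of n "out_dist n M"] capacity_out_dist_pos[OF assms]
    unfolding mutual_info_eq[OF M] by simp
qed

text \<open>Complementary slackness: the average of the divergence over \<open>M\<close> is the
  capacity itself, so a divergence that never exceeds the capacity equals it almost surely.\<close>

lemma capacity_kkt_AE:
  assumes "capacity_achieving n M"
  shows "AE x in M. kernel_div n x (out_dist n M) = mutual_info n M"
proof -
  have M: "input_dist M" using assms by (simp add: capacity_achieving_def)
  interpret prob_space M using M by (simp add: input_dist_def)
  let ?g = "\<lambda>x. mutual_info n M - kernel_div n x (out_dist n M)"
  have i: "integrable M (\<lambda>x. kernel_div n x (out_dist n M))"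
    using capacity_out_dist_pos[OF assms] by (intro integrable_kernel_div M) auto
  have "AE x in M. 0 \<le> ?g x" using input_dist_AE[OF M] capacity_kkt[OF assms] by auto
  moreover have "(\<integral>x. ?g x \<partial>M) = 0"
    using i mutual_info_eq_integral_kernel_div[OF assms] prob_space by simp
  ultimately have "AE x in M. ?g x = 0"
    using integral_nonneg_eq_0_iff_AE[of M ?g] i by simp
  then show ?thesis by auto
qed

text \<open>The gap between the two sides is \<open>D(Q \<parallel> ref)\<close>.\<close>

lemma mutual_info_le_integral_kernel_div_ref:
  assumes "capacity_achieving n M"
  shows "mutual_info n M \<le> (\<integral>x. kernel_div n x (ref_out n) \<partial>M)"
proof -
  have M: "input_dist M" using assms by (simp add: capacity_achieving_def)
  let ?Q = "out_dist n M"
  have Q: "?Q y > 0" if "y \<le> n" for y using capacity_out_dist_pos[OF assms that] .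
  have "(\<Sum>y\<le>n. ?Q y * ln (?Q y / ref_out n y)) \<ge> 0"
    using Q ref_out_pos by (intro gibbs_inequality) (auto simp: sum_out_dist[OF M] sum_ref_out less_imp_le)
  moreover have "(\<Sum>y\<le>n. ?Q y * ln (?Q y / ref_out n y)) = (\<Sum>y\<le>n. ?Q y * ln (?Q y)) - (\<Sum>y\<le>n. ?Q y * ln (ref_out n y))"
    unfolding sum_subtractf[symmetric] using Q ref_out_pos
    by (intro sum.cong refl) (auto simp: ln_div right_diff_distrib less_imp_neq[symmetric])
  ultimately show ?thesis
    unfolding mutual_info_eq[OF M] using integrable_kernel_div(2)[OF M, of n "ref_out n"] ref_out_pos by simp
qed

subsection \<open>Mass of short angular intervals\<close>

lemma power_le_exp:
  fixes r :: real assumes "0 \<le> r" shows "r ^ m \<le> exp (real m * (r - 1))"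
proof -
  have "r ^ m \<le> exp (r - 1) ^ m" using assms exp_ge_add_one_self[of "r - 1"] by (intro power_mono) auto
  then show ?thesis by (simp add: exp_of_nat_mult)
qed

text \<open>The second summand of the exponent is centred under input \<open>x\<close>, so an
  expectation leaves only the first one, which is \<open>n\<close> times the chi-square divergence
  of a single trial.\<close>

lemma binom_kernel_ratio_le:
  assumes "0 \<le> x" "x \<le> 1" "0 < x0" "x0 < 1" "y \<le> n"
  shows "binom_kernel n x y \<le> binom_kernel n x0 y * exp (real n * (x - x0)\<^sup>2 / (x0 * (1 - x0)) + (x - x0) / (x0 * (1 - x0)) * (real y - real n * x))"
proof -
  have "binom_kernel n x y = binom_kernel n x0 y * ((x / x0) ^ y * ((1 - x) / (1 - x0)) ^ (n - y))"
    using assms by (simp add: binom_kernel_def power_divide)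
  also have "\<dots> \<le> binom_kernel n x0 y * (exp (real y * (x / x0 - 1)) * exp (real (n - y) * ((1 - x) / (1 - x0) - 1)))"
    using assms by (intro mult_left_mono mult_mono power_le_exp) auto
  also have "exp (real y * (x / x0 - 1)) * exp (real (n - y) * ((1 - x) / (1 - x0) - 1))
      = exp (real y * (x / x0 - 1) + real (n - y) * ((1 - x) / (1 - x0) - 1))" by (simp add: exp_add)
  also have "real y * (x / x0 - 1) + real (n - y) * ((1 - x) / (1 - x0) - 1)
      = real n * (x - x0)\<^sup>2 / (x0 * (1 - x0)) + (x - x0) / (x0 * (1 - x0)) * (real y - real n * x)"
  proof -
    have n: "real (n - y) = real n - real y" using assms by simp
    have "1 - x0 \<noteq> 0" "x0 \<noteq> 0" using assms by auto
    then show ?thesis unfolding n by (simp add: divide_simps power2_eq_square) (simp add: algebra_simps)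
  qed
  finally show ?thesis .
qed

lemma kernel_div_kernel_le:
  assumes "0 \<le> x" "x \<le> 1" "0 < x0" "x0 < 1"
  shows "kernel_div n x (binom_kernel n x0) \<le> real n * (x - x0)\<^sup>2 / (x0 * (1 - x0))"
proof -
  let ?e = "\<lambda>y. real n * (x - x0)\<^sup>2 / (x0 * (1 - x0)) + (x - x0) / (x0 * (1 - x0)) * (real y - real n * x)"
  have "binom_kernel n x y * ln (binom_kernel n x y / binom_kernel n x0 y) \<le> binom_kernel n x y * ?e y" if "y \<le> n" for y
  proof (cases "binom_kernel n x y = 0")
    case False
    then have k: "binom_kernel n x y > 0" using binom_kernel_nonneg[OF assms(1,2), of n y] by linarith
    have k0: "binom_kernel n x0 y > 0" using assms that by (intro binom_kernel_pos) auto
    have "binom_kernel n x y / binom_kernel n x0 y \<le> exp (?e y)"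
      using binom_kernel_ratio_le[OF assms that] k0 by (simp add: divide_le_eq mult.commute)
    then have "ln (binom_kernel n x y / binom_kernel n x0 y) \<le> ?e y"
      using k k0 by (metis divide_pos_pos exp_gt_zero ln_exp ln_le_cancel_iff)
    then show ?thesis using k by (intro mult_left_mono) auto
  qed simp
  then have "kernel_div n x (binom_kernel n x0) \<le> (\<Sum>y\<le>n. binom_kernel n x y * ?e y)"
    unfolding kernel_div_def by (intro sum_mono) auto
  also have "\<dots> = real n * (x - x0)\<^sup>2 / (x0 * (1 - x0))"
    using binom_central_moments[of n x "real n * (x - x0)\<^sup>2 / (x0 * (1 - x0))" "(x - x0) / (x0 * (1 - x0))" 0 0 0] by simp
  finally show ?thesis .
qed

text \<open>Averaging the optimality condition over \<open>B\<close>: an input distribution that puts mass \<open>m\<close> on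
  nearly indistinguishable inputs conveys at most about \<open>- ln m\<close> there.\<close>
lemma capacity_block_mass:
  assumes "capacity_achieving n M" "B \<in> sets borel" "0 < x0" "x0 < 1"
    and d: "\<And>x. x \<in> B \<Longrightarrow> 0 \<le> x \<Longrightarrow> x \<le> 1 \<Longrightarrow> kernel_div n x (binom_kernel n x0) \<le> d"
  shows "measure M B \<le> exp (d - mutual_info n M)"
proof (cases "measure M B = 0")
  case False
  have M: "input_dist M" using assms by (simp add: capacity_achieving_def)
  interpret prob_space M using M by (simp add: input_dist_def)
  have B: "B \<in> sets M" using M assms(2) by (simp add: input_dist_def)
  define m where "m = measure M B"
  have m: "m > 0" using False by (simp add: m_def zero_less_measure_iff)
  let ?Q = "out_dist n M" and ?P = "binom_kernel n x0" and ?C = "mutual_info n M"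
  have Q: "?Q y > 0" if "y \<le> n" for y using capacity_out_dist_pos[OF assms(1) that] .
  have P: "?P y > 0" if "y \<le> n" for y using assms that by (intro binom_kernel_pos) auto
  let ?c = "\<lambda>y. m * ?P y / ?Q y"
  \<comment> \<open>Off \<open>B\<close> the right-hand side is merely nonnegative. Its integral is
    exactly \<open>m\<close>: the mean of the kernel cancels \<open>?Q y\<close>, and
    \<open>?P\<close> sums to \<open>1\<close>.\<close>
  have "AE x in M. indicator B x * (?C - d + 1 + ln m) \<le> (\<Sum>y\<le>n. binom_kernel n x y * ?c y)"
    using capacity_kkt_AE[OF assms(1)] input_dist_AE[OF M]
  proof eventually_elim
    case (elim x)
    then have x: "0 \<le> x" "x \<le> 1" by auto
    have nn: "(\<Sum>y\<le>n. binom_kernel n x y * ?c y) \<ge> 0"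
      using x Q P m by (intro sum_nonneg mult_nonneg_nonneg divide_nonneg_nonneg) (auto simp: less_imp_le)
    show ?case
    proof (cases "x \<in> B")
      case True
      have "?C = kernel_div n x ?P + (\<Sum>y\<le>n. binom_kernel n x y * ln (?P y / ?Q y))"
        using kernel_div_eq[of n ?P ?Q x] P Q x elim(1) by simp
      also have "\<dots> \<le> d + (\<Sum>y\<le>n. binom_kernel n x y * (?c y - (1 + ln m)))"
      proof (intro add_mono d[OF True x] sum_mono mult_left_mono)
        fix y assume "y \<in> {..n}"
        then have pq: "?P y > 0" "?Q y > 0" using P Q by auto
        \<comment> \<open>Including the factor \<open>m\<close> before linearising makes the average
          read \<open>m * (?C - d + 1 + ln m) \<le> m\<close>, where the two constants
          \<open>1\<close> cancel.\<close>
        have "ln (?c y) \<le> ?c y - 1" using pq m by (intro ln_le_minus_one) auto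
        moreover have "ln (?c y) = ln m + ln (?P y / ?Q y)" using pq m by (simp add: ln_mult ln_div)
        ultimately show "ln (?P y / ?Q y) \<le> ?c y - (1 + ln m)" by linarith
      qed (use x in auto)
      also have "(\<Sum>y\<le>n. binom_kernel n x y * (?c y - (1 + ln m))) = (\<Sum>y\<le>n. binom_kernel n x y * ?c y) - (1 + ln m)"
        by (simp only: right_diff_distrib sum_subtractf sum_distrib_right[symmetric] sum_binom_kernel mult_1)
      finally show ?thesis using True by simp
    next
      case False
      then show ?thesis using nn by simp
    qed
  qed
  then have "(\<integral>x. indicator B x * (?C - d + 1 + ln m) \<partial>M) \<le> (\<integral>x. (\<Sum>y\<le>n. binom_kernel n x y * ?c y) \<partial>M)"
    using B integral_sum_binom_kernel(1)[OF M, of n ?c] by (intro integral_mono_AE) (auto simp: emeasure_eq_measure)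
  also have "(\<integral>x. (\<Sum>y\<le>n. binom_kernel n x y * ?c y) \<partial>M) = (\<Sum>y\<le>n. m * ?P y)"
    unfolding integral_sum_binom_kernel(2)[OF M] using Q by (intro sum.cong) (auto simp: less_imp_neq[symmetric])
  also have "\<dots> = m" by (simp add: sum_distrib_left[symmetric])
  also have "(\<integral>x. indicator B x * (?C - d + 1 + ln m) \<partial>M) = m * (?C - d + 1 + ln m)"
    using B sets.sets_into_space[OF B] by (simp add: m_def Int_absorb1)
  finally have "m * (?C - d + 1 + ln m) \<le> m * 1" by simp
  then have "ln m \<le> d - ?C" using m by (simp only: mult_le_cancel_left_pos)
  then show ?thesis using m by (metis exp_le_cancel_iff exp_ln m_def)
qed simp

text \<open>The substitution \<open>x = (sin t)\<^sup>2\<close> makes the Fisher information of the binomial family constant,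
  so equal angular blocks are equally hard to resolve.\<close>
lemma sin_squared_diff: "(sin a)\<^sup>2 - (sin b)\<^sup>2 = sin (a - b) * sin (a + b)" for a b :: real
proof -
  have "sin (a - b) * sin (a + b) = (sin a)\<^sup>2 * (cos b)\<^sup>2 - (cos a)\<^sup>2 * (sin b)\<^sup>2"
    by (simp add: sin_add sin_diff power2_eq_square algebra_simps)
  also have "\<dots> = (sin a)\<^sup>2 - (sin b)\<^sup>2" by (simp add: cos_squared_eq algebra_simps)
  finally show ?thesis by simp
qed

text \<open>The numerator is \<open>(sin (t - s) * sin (t + s))\<^sup>2\<close> and the denominator
  \<open>(sin (2 * s))\<^sup>2 / 4\<close>. The assumptions let the factors of the sum angle cancel,
  which keeps the bound uniform up to the ends of the quadrant.\<close>

lemma sin_squared_chi_le: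
  fixes s t :: real
  assumes "sin (t + s) \<le> sin (2 * s)" "0 \<le> sin (t + s)" "0 < sin (2 * s)"
  shows "((sin t)\<^sup>2 - (sin s)\<^sup>2)\<^sup>2 / ((sin s)\<^sup>2 * (1 - (sin s)\<^sup>2)) \<le> 4 * (t - s)\<^sup>2"
proof -
  have 1: "(sin s)\<^sup>2 * (1 - (sin s)\<^sup>2) = (sin (2 * s))\<^sup>2 / 4"
    by (simp add: sin_double cos_squared_eq[symmetric] power_mult_distrib)
  have "(sin (t - s))\<^sup>2 \<le> (t - s)\<^sup>2"
    using abs_sin_le_one abs_sin_x_le_abs_x[of "t - s"] by (metis abs_le_square_iff)
  moreover have "(sin (t + s))\<^sup>2 \<le> (sin (2 * s))\<^sup>2" using assms by (intro power_mono) auto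
  ultimately have "(sin (t - s) * sin (t + s))\<^sup>2 \<le> (t - s)\<^sup>2 * (sin (2 * s))\<^sup>2"
    unfolding power_mult_distrib by (intro mult_mono) auto
  then show ?thesis unfolding 1 sin_squared_diff using assms by (simp add: field_simps)
qed

lemma capacity_angle_block_mass:
  fixes K j :: nat
  assumes cap: "capacity_achieving n M" and n: "n \<ge> 1" and K: "real K \<ge> 2 * sqrt (real n)" and j: "j < 2 * K"
  defines "\<delta> \<equiv> pi / (4 * real K)"
  shows "measure M {(sin (real j * \<delta>))\<^sup>2..(sin (real (Suc j) * \<delta>))\<^sup>2} \<le> exp (pi\<^sup>2 / 16 - mutual_info n M)"
proof -
  have Kpos: "real K > 0" using j by simp
  have \<delta>: "\<delta> > 0" "real K * \<delta> = pi / 4" using Kpos by (simp_all add: \<delta>_def)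
  have n\<delta>: "4 * real n * \<delta>\<^sup>2 \<le> pi\<^sup>2 / 16"
  proof -
    have "4 * real n = (2 * sqrt (real n))\<^sup>2" by (simp add: power_mult_distrib)
    also have "\<dots> \<le> (real K)\<^sup>2" using K by (intro power_mono) auto
    finally have "4 * real n * \<delta>\<^sup>2 \<le> (real K)\<^sup>2 * \<delta>\<^sup>2" by (intro mult_right_mono) auto
    also have "\<dots> = (pi / 4)\<^sup>2" by (simp only: power_mult_distrib[symmetric] \<delta>(2))
    finally show ?thesis by (simp add: power_divide)
  qed
  \<comment> \<open>The comparison point is the end of the block nearer to \<open>pi / 4\<close>:
    there \<open>sin (2 * s)\<close> is largest on the block, and \<open>s\<close> avoids
    \<open>0\<close> and \<open>pi / 2\<close> even for the outermost blocks.\<close>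
  define s where "s = (if j < K then real (Suc j) * \<delta> else real j * \<delta>)"
  have jle: "real j * \<delta> \<le> pi / 2" "real (Suc j) * \<delta> \<le> pi / 2" 
  proof -
    have "real (Suc j) * \<delta> \<le> (2 * real K) * \<delta>" using j \<delta> by (intro mult_right_mono) auto
    then show "real (Suc j) * \<delta> \<le> pi / 2" using \<delta>(2) by simp
    moreover have "real j * \<delta> \<le> real (Suc j) * \<delta>" using \<delta> by (intro mult_right_mono) auto
    ultimately show "real j * \<delta> \<le> pi / 2" by linarith
  qed
  have key: "sin (t + s) \<le> sin (2 * s) \<and> 0 \<le> sin (t + s) \<and> 0 < sin (2 * s) \<and> \<bar>t - s\<bar> \<le> \<delta> \<and> 0 < s \<and> s < pi / 2"
    if t: "real j * \<delta> \<le> t" "t \<le> real (Suc j) * \<delta>" for t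
  proof (cases "j < K")
    case True
    then have s: "s = real (Suc j) * \<delta>" by (simp add: s_def)
    have "real (Suc j) * \<delta> \<le> real K * \<delta>" using True \<delta> by (intro mult_right_mono) auto
    then have s4: "s \<le> pi / 4" using s \<delta>(2) by simp
    have s0: "s > 0" using \<delta> s by simp
    have t0: "0 \<le> t" using t(1) \<delta> by (smt (verit) mult_nonneg_nonneg of_nat_0_le_iff)
    have ts: "t \<le> s" using t(2) s by simp
    have "sin (t + s) \<le> sin (2 * s)" using ts s4 s0 t0 by (intro sin_mono_le_eq[THEN iffD2]) auto
    moreover have "0 \<le> sin (t + s)" using ts s4 s0 t0 by (intro sin_ge_zero) auto
    moreover have "0 < sin (2 * s)" using s4 s0 by (intro sin_gt_zero) auto
    moreover have "\<bar>t - s\<bar> \<le> \<delta>" using t s by (simp add: algebra_simps)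
    ultimately show ?thesis using s0 s4 by auto
  next
    case False
    then have s: "s = real j * \<delta>" by (simp add: s_def)
    have "real K * \<delta> \<le> real j * \<delta>" using False \<delta> by (intro mult_right_mono) auto
    then have s4: "pi / 4 \<le> s" using s \<delta>(2) by simp
    have s2: "s < pi / 2" using jle(2) s \<delta> by (simp add: algebra_simps)
    have t2: "t \<le> pi / 2" using t(2) jle(2) by linarith
    have ts: "s \<le> t" using t(1) s by simp
    \<comment> \<open>Past \<open>pi / 4\<close> the sum angles lie in \<open>[pi / 2, pi]\<close>;
      reflection at \<open>pi / 2\<close> moves them to where \<open>sin\<close> increases.\<close>
    have "sin (pi - (t + s)) \<le> sin (pi - 2 * s)" using ts s4 s2 t2 by (intro sin_mono_le_eq[THEN iffD2]) auto
    then have "sin (t + s) \<le> sin (2 * s)" by simp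
    moreover have "0 \<le> sin (t + s)" using ts s4 s2 t2 by (intro sin_ge_zero) auto
    moreover have "0 < sin (2 * s)" using s4 s2 by (intro sin_gt_zero) auto
    moreover have "\<bar>t - s\<bar> \<le> \<delta>" using t s by (simp add: algebra_simps)
    ultimately show ?thesis using s2 s4 by auto
  qed
  have s: "0 < s" "s < pi / 2" using key[of "real j * \<delta>"] \<delta> by (auto intro: mult_right_mono)
  have s1: "0 < (sin s)\<^sup>2" "(sin s)\<^sup>2 < 1"
  proof -
    have "sin s > 0" "cos s > 0" using s by (auto intro: sin_gt_zero cos_gt_zero)
    then show "0 < (sin s)\<^sup>2" by simp
    have "(cos s)\<^sup>2 > 0" using \<open>cos s > 0\<close> by simp
    then show "(sin s)\<^sup>2 < 1" by (simp add: cos_squared_eq)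
  qed
  show ?thesis
  proof (rule capacity_block_mass[OF cap _ s1])
    fix x assume x: "x \<in> {(sin (real j * \<delta>))\<^sup>2..(sin (real (Suc j) * \<delta>))\<^sup>2}" "0 \<le> x" "x \<le> 1"
    have "\<exists>t\<ge>real j * \<delta>. t \<le> real (Suc j) * \<delta> \<and> (sin t)\<^sup>2 = x"
      using x \<delta> by (intro IVT') (auto intro!: continuous_intros mult_right_mono)
    then obtain t where t: "real j * \<delta> \<le> t" "t \<le> real (Suc j) * \<delta>" "x = (sin t)\<^sup>2" by auto
    have "kernel_div n x (binom_kernel n ((sin s)\<^sup>2)) \<le> real n * (x - (sin s)\<^sup>2)\<^sup>2 / ((sin s)\<^sup>2 * (1 - (sin s)\<^sup>2))"
      using x s1 by (intro kernel_div_kernel_le) auto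
    also have "\<dots> = real n * ((x - (sin s)\<^sup>2)\<^sup>2 / ((sin s)\<^sup>2 * (1 - (sin s)\<^sup>2)))" by simp
    also have "\<dots> \<le> real n * (4 * (t - s)\<^sup>2)"
      unfolding t(3) using key[OF t(1,2)] by (intro mult_left_mono sin_squared_chi_le) auto
    also have "\<dots> \<le> real n * (4 * \<delta>\<^sup>2)"
      using key[OF t(1,2)] \<delta> by (intro mult_left_mono) (auto simp: abs_le_square_iff[symmetric])
    also have "\<dots> \<le> pi\<^sup>2 / 16" using n\<delta> by (simp add: mult_ac)
    finally show "kernel_div n x (binom_kernel n ((sin s)\<^sup>2)) \<le> pi\<^sup>2 / 16" .
  qed simp
qed

section \<open>Unimodality in the input and the pointwise bound on the optimal output law\<close>

lemma binom_kernel_mono: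
  assumes "0 \<le> a" "a \<le> b" "b \<le> 1" "real n * b \<le> real y" "y \<le> n"
  shows "binom_kernel n a y \<le> binom_kernel n b y"
proof -
  consider "b = 0" | "b = 1" | "0 < b" "b < 1" using assms by linarith
  then show ?thesis
  proof cases
    case 1
    then show ?thesis using assms by simp
  next
    case 2
    then have "y = n" using assms by simp
    then show ?thesis using 2 assms binom_kernel_le_1[of a n n] by (simp add: binom_kernel_def)
  next
    case 3
    \<comment> \<open>With base point \<open>b\<close> the exponent of the ratio bound collapses to
      a product whose sign is read off from \<open>a \<le> b\<close> and
      \<open>n * b \<le> y\<close>, so monotonicity follows without differentiating.\<close>
    have "real n * (a - b)\<^sup>2 / (b * (1 - b)) + (a - b) / (b * (1 - b)) * (real y - real n * a)
        = (a - b) * (real y - real n * b) / (b * (1 - b))"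
      using 3 by (simp add: divide_simps power2_eq_square) (simp add: algebra_simps)
    also have "\<dots> \<le> 0"
      using 3 assms by (intro divide_nonpos_nonneg mult_nonpos_nonneg) auto
    finally have "binom_kernel n b y * exp (real n * (a - b)\<^sup>2 / (b * (1 - b)) + (a - b) / (b * (1 - b)) * (real y - real n * a))
        \<le> binom_kernel n b y * 1"
      using assms by (intro mult_left_mono) auto
    then show ?thesis using binom_kernel_ratio_le[of a b y n] 3 assms by simp
  qed
qed

lemma binom_kernel_antimono:
  assumes "0 \<le> a" "a \<le> b" "b \<le> 1" "real y \<le> real n * a" "y \<le> n"
  shows "binom_kernel n b y \<le> binom_kernel n a y"
  using binom_kernel_mono[of "1 - b" "1 - a" n "n - y"] assms
  by (simp add: binom_kernel_reflect right_diff_distrib)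

text \<open>A unimodal function bounded by \<open>m\<close> has variation at most \<open>2 * m\<close>; this is the variation
  accumulated from the left.\<close>
definition kernel_var :: "nat \<Rightarrow> nat \<Rightarrow> real \<Rightarrow> real \<Rightarrow> real" where
  "kernel_var n y m x = (if real n * x \<le> real y then binom_kernel n x y else 2 * m - binom_kernel n x y)"

lemma kernel_var_diff:
  assumes "\<And>x. 0 \<le> x \<Longrightarrow> x \<le> 1 \<Longrightarrow> binom_kernel n x y \<le> m" "y \<le> n" "0 \<le> a" "a \<le> b" "b \<le> 1"
  shows "\<bar>binom_kernel n a y - binom_kernel n b y\<bar> \<le> kernel_var n y m b - kernel_var n y m a"
proof -
  have nab: "real n * a \<le> real n * b" using assms by (intro mult_left_mono) auto
  consider "real n * b \<le> real y" | "real y < real n * a" | "real n * a \<le> real y" "real y < real n * b" by linarith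
  then show ?thesis
  proof cases
    case 1
    then show ?thesis using binom_kernel_mono[of a b n y] nab assms by (simp add: kernel_var_def)
  next
    case 2
    then show ?thesis using binom_kernel_antimono[of a b y n] nab assms by (simp add: kernel_var_def)
  next
    case 3
    then show ?thesis using assms(1)[of a] assms(1)[of b] assms(3-5) by (simp add: kernel_var_def)
  qed
qed

lemma integral_sum_blocks:
  fixes g :: "real \<Rightarrow> real"
  assumes "continuous_on UNIV g" "0 \<le> \<delta>"
  shows "(\<Sum>j<N. integral {real j * \<delta>..real (Suc j) * \<delta>} g) = integral {0..real N * \<delta>} g"
proof (induction N)
  case (Suc N)
  have "real N * \<delta> \<le> real (Suc N) * \<delta>" using assms by (intro mult_right_mono) auto
  then have "integral {0..real N * \<delta>} g + integral {real N * \<delta>..real (Suc N) * \<delta>} g = integral {0..real (Suc N) * \<delta>} g"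
    using assms by (intro Henstock_Kurzweil_Integration.integral_combine integrable_continuous_interval)
      (auto intro: continuous_on_subset)
  then show ?case using Suc by simp
qed simp

lemma sin_squared_mono:
  assumes "0 \<le> a" "a \<le> b" "b \<le> pi / 2" shows "(sin a)\<^sup>2 \<le> (sin b)\<^sup>2"
  using assms by (intro power_mono sin_mono_le_eq[THEN iffD2] sin_ge_zero) auto

text \<open>On each block the kernel is at most its angular average plus its variation there. All
  blocks share one mass bound, the averages sum to \<open>2 * K * ref_out n y\<close>, and the
  variations telescope to at most \<open>2 * m\<close>.\<close>

lemma capacity_out_dist_le:
  fixes K :: nat
  assumes cap: "capacity_achieving n M" and n: "n \<ge> 1" and K: "real K \<ge> 2 * sqrt (real n)" and y: "y \<le> n"
    and m: "\<And>x. 0 \<le> x \<Longrightarrow> x \<le> 1 \<Longrightarrow> binom_kernel n x y \<le> m"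
  shows "out_dist n M y \<le> exp (pi\<^sup>2 / 16 - mutual_info n M) * (2 * real K * ref_out n y + 2 * m)"
proof -
  have M: "input_dist M" using cap by (simp add: capacity_achieving_def)
  interpret prob_space M using M by (simp add: input_dist_def)
  have sM: "sets M = sets borel" using M by (simp add: input_dist_def)
  define \<kappa> where "\<kappa> = exp (pi\<^sup>2 / 16 - mutual_info n M)"
  have "2 * sqrt (real n) > 0" using n by simp
  then have Kpos: "real K > 0" using K by linarith
  define \<delta> where "\<delta> = pi / (4 * real K)"
  have \<delta>: "\<delta> > 0" "real (2 * K) * \<delta> = pi / 2" using Kpos by (simp_all add: \<delta>_def)
  define p where "p = (\<lambda>j. (sin (real j * \<delta>))\<^sup>2)"
  define g where "g = (\<lambda>t. binom_kernel n ((sin t)\<^sup>2) y)"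
  define V where "V = kernel_var n y m"
  define s where "s j = integral {real j * \<delta>..real (Suc j) * \<delta>} g / \<delta> + (V (p (Suc j)) - V (p j))" for j
  have gc: "continuous_on S g" for S unfolding g_def binom_kernel_def by (intro continuous_intros)
  have Vd: "\<bar>binom_kernel n a y - binom_kernel n b y\<bar> \<le> V b - V a" if "0 \<le> a" "a \<le> b" "b \<le> 1" for a b
    unfolding V_def using that by (intro kernel_var_diff m y) auto
  have jle: "real j * \<delta> \<le> pi / 2" if "j \<le> 2 * K" for j
  proof -
    have "real j * \<delta> \<le> real (2 * K) * \<delta>" using that \<delta> by (intro mult_right_mono) auto
    then show ?thesis using \<delta>(2) by linarith
  qed
  have pmono: "p i \<le> p j" if "i \<le> j" "j \<le> 2 * K" for i j
    unfolding p_def using that \<delta> jle[of j] by (intro sin_squared_mono) (auto intro: mult_right_mono)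
  have p01: "0 \<le> p j" "p j \<le> 1" for j by (auto simp: p_def abs_square_le_1)
  have ks: "binom_kernel n x y \<le> s j" if j: "j < 2 * K" and x: "x \<in> {p j..p (Suc j)}" for x j
  proof -
    have x01: "0 \<le> x" "x \<le> 1" using x p01[of j] p01[of "Suc j"] by auto
    let ?I = "{real j * \<delta>..real (Suc j) * \<delta>}"
    have "binom_kernel n x y - (V (p (Suc j)) - V (p j)) \<le> g t" if t: "t \<in> ?I" for t
    proof -
      have "0 \<le> real j * \<delta>" using \<delta> by simp
      then have st: "p j \<le> (sin t)\<^sup>2" "(sin t)\<^sup>2 \<le> p (Suc j)"
        unfolding p_def using t jle[of "Suc j"] j by (auto intro!: sin_squared_mono)
      have "binom_kernel n x y - g t \<le> \<bar>V x - V ((sin t)\<^sup>2)\<bar>"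
        unfolding g_def using Vd[of x "(sin t)\<^sup>2"] Vd[of "(sin t)\<^sup>2" x] x01 
        by (cases "x \<le> (sin t)\<^sup>2") (auto simp: abs_square_le_1)
      also have "\<dots> \<le> V (p (Suc j)) - V (p j)"
        using Vd[of "p j" x] Vd[of "p j" "(sin t)\<^sup>2"] Vd[of x "p (Suc j)"] Vd[of "(sin t)\<^sup>2" "p (Suc j)"] x st p01 x01
        by (simp add: abs_square_le_1)
      finally show ?thesis by simp
    qed
    then have "integral ?I (\<lambda>t. binom_kernel n x y - (V (p (Suc j)) - V (p j))) \<le> integral ?I g"
      by (intro integral_le integrable_continuous_interval gc continuous_on_const) auto
    moreover have "integral ?I (\<lambda>t. c) = \<delta> * c" for c :: real
    proof -
      have "real j * \<delta> \<le> real (Suc j) * \<delta>" using \<delta> by (intro mult_right_mono) auto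
      moreover have "real (Suc j) * \<delta> - real j * \<delta> = \<delta>" by (simp add: algebra_simps)
      ultimately show ?thesis by (simp del: of_nat_Suc)
    qed
    ultimately have "\<delta> * (binom_kernel n x y - (V (p (Suc j)) - V (p j))) \<le> integral ?I g"
      by (simp only:)
    then show ?thesis unfolding s_def using \<delta> by (simp add: field_simps)
  qed
  have s0: "s j \<ge> 0" if "j < 2 * K" for j
    using order.trans[OF binom_kernel_nonneg ks[OF that, of "p j"]] p01 pmono[of j "Suc j"] that by auto
  have cover: "\<exists>j<2 * K. x \<in> {p j..p (Suc j)}" if x: "0 \<le> x" "x \<le> 1" for x
  proof -
    have ex: "x \<le> p (2 * K)" using x by (simp only: p_def \<delta>(2)) simp
    \<comment> \<open>The least grid index with \<open>x \<le> p i\<close> locates the block; index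
      \<open>0\<close> occurs only for \<open>x = 0\<close>, which belongs to the first
      block.\<close>
    define i where "i = (LEAST i. x \<le> p i)"
    have i: "x \<le> p i" "i \<le> 2 * K" unfolding i_def by (auto intro: LeastI Least_le ex)
    show ?thesis
    proof (cases i)
      case 0
      then have "x = p 0" using i x by (simp add: p_def)
      then show ?thesis using pmono[of 0 1] Kpos by (intro exI[of _ 0]) auto
    next
      case (Suc j)
      then have "\<not> x \<le> p j" unfolding i_def using not_less_Least by (metis lessI)
      then show ?thesis using i Suc by (intro exI[of _ j]) auto
    qed
  qed
  have ii: "integrable M (\<lambda>x. indicator {p j..p (Suc j)} x * s j)" for j
    using sM by (intro integrable_mult_left integrable_real_indicator) (auto simp: emeasure_eq_measure)
  have "out_dist n M y \<le> (\<integral>x. (\<Sum>j<2 * K. indicator {p j..p (Suc j)} x * s j) \<partial>M)"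
    unfolding out_dist_def
  proof (rule input_dist_integral_mono[OF M integrable_binom_kernel[OF M y]])
    show "integrable M (\<lambda>x. \<Sum>j<2 * K. indicator {p j..p (Suc j)} x * s j)"
      by (intro Bochner_Integration.integrable_sum ii)
    fix x :: real assume "0 \<le> x" "x \<le> 1"
    from cover[OF this] obtain j where j: "j < 2 * K" "x \<in> {p j..p (Suc j)}" by auto
    have "binom_kernel n x y \<le> indicator {p j..p (Suc j)} x * s j" using ks[OF j] j(2) by simp
    also have "\<dots> \<le> (\<Sum>j<2 * K. indicator {p j..p (Suc j)} x * s j)"
      using j s0 by (intro member_le_sum) auto
    finally show "binom_kernel n x y \<le> (\<Sum>j<2 * K. indicator {p j..p (Suc j)} x * s j)" .
  qed
  also have "\<dots> = (\<Sum>j<2 * K. measure M {p j..p (Suc j)} * s j)"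
  proof -
    have sp: "space M = UNIV" using sets_eq_imp_space_eq[OF sM] by simp
    show ?thesis using ii by (subst Bochner_Integration.integral_sum) (auto simp: sp)
  qed
  also have "\<dots> \<le> (\<Sum>j<2 * K. \<kappa> * s j)"
    using capacity_angle_block_mass[OF cap n K] s0 unfolding \<kappa>_def p_def \<delta>_def
    by (intro sum_mono mult_right_mono) auto
  also have "\<dots> = \<kappa> * (\<Sum>j<2 * K. s j)" by (simp add: sum_distrib_left)
  also have "(\<Sum>j<2 * K. s j) = integral {0..real (2 * K) * \<delta>} g / \<delta> + (V (p (2 * K)) - V (p 0))"
    unfolding s_def sum.distrib sum_divide_distrib[symmetric]
    using integral_sum_blocks[OF gc[of UNIV], of \<delta> "2 * K"] \<delta>(1) sum_lessThan_telescope[of "\<lambda>j. V (p j)" "2 * K"] by simp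
  also have "integral {0..real (2 * K) * \<delta>} g / \<delta> = 2 * real K * ref_out n y"
    unfolding g_def \<delta>(2) integral_unique[OF has_integral_binom_kernel_sin[OF y]] by (simp add: \<delta>_def)
  also have "V (p (2 * K)) - V (p 0) \<le> 2 * m"
    using m[OF p01, of "2 * K"] m[OF p01, of 0] binom_kernel_nonneg[OF p01, of n "2 * K" y] binom_kernel_nonneg[OF p01, of n 0 y]
    unfolding V_def kernel_var_def by argo
  finally show ?thesis unfolding \<kappa>_def by simp
qed

lemma capacity_interval_mass:
  fixes K :: nat
  assumes cap: "capacity_achieving n M" and n: "n \<ge> 1" and K: "real K \<ge> 2 * sqrt (real n)" and ab: "a < b" "b \<le> 2 * K"
  defines "\<delta> \<equiv> pi / (4 * real K)"
  shows "measure M {(sin (real a * \<delta>))\<^sup>2..(sin (real b * \<delta>))\<^sup>2} \<le> (real b - real a) * exp (pi\<^sup>2 / 16 - mutual_info n M)"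
proof -
  have M: "input_dist M" using cap by (simp add: capacity_achieving_def)
  interpret prob_space M using M by (simp add: input_dist_def)
  have sM: "sets M = sets borel" using M by (simp add: input_dist_def)
  define p where "p = (\<lambda>j. (sin (real j * \<delta>))\<^sup>2)"
  have "Suc a \<le> b" using ab by simp
  then have "b \<le> 2 * K \<longrightarrow> prob {p a..p b} \<le> (real b - real a) * exp (pi\<^sup>2 / 16 - mutual_info n M)"
  proof (induction b rule: dec_induct)
    case base
    then show ?case using capacity_angle_block_mass[OF cap n K, of a] by (simp add: p_def \<delta>_def)
  next
    case (step b)
    show ?case
    proof
      assume b: "Suc b \<le> 2 * K"
      have "{p a..p (Suc b)} \<subseteq> {p a..p b} \<union> {p b..p (Suc b)}" by auto
      then have "prob {p a..p (Suc b)} \<le> prob ({p a..p b} \<union> {p b..p (Suc b)})" using sM by (intro finite_measure_mono) auto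
      also have "\<dots> \<le> prob {p a..p b} + prob {p b..p (Suc b)}" using sM by (intro measure_Un_le) auto
      also have "\<dots> \<le> (real b - real a) * exp (pi\<^sup>2 / 16 - mutual_info n M) + exp (pi\<^sup>2 / 16 - mutual_info n M)"
        using step b capacity_angle_block_mass[OF cap n K, of b] by (intro add_mono) (auto simp: p_def \<delta>_def)
      finally show "prob {p a..p (Suc b)} \<le> (real (Suc b) - real a) * exp (pi\<^sup>2 / 16 - mutual_info n M)"
        by (simp add: algebra_simps)
    qed
  qed
  then show ?thesis using ab by (simp add: p_def)
qed

section \<open>Relative entropy and two-sided bounds on the capacity\<close>

lemma capacity_rel_entropy_le:
  assumes cap: "capacity_achieving n M" and \<alpha>: "0 \<le> \<alpha>" "\<alpha> \<le> pi / 4"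
    and l: "\<And>t. \<alpha> \<le> t \<Longrightarrow> t \<le> pi / 2 - \<alpha> \<Longrightarrow> l \<le> kernel_div n ((sin t)\<^sup>2) (ref_out n)"
  shows "rel_entropy n (ref_out n) (out_dist n M) \<le> mutual_info n M - (1 - 4 * \<alpha> / pi) * l"
proof -
  let ?Q = "out_dist n M" and ?C = "mutual_info n M"
  let ?J = "{\<alpha>..pi/2 - \<alpha>}"
  have Q: "?Q y > 0" if "y \<le> n" for y using capacity_out_dist_pos[OF cap that] .
  have re: "rel_entropy n (ref_out n) ?Q = (\<Sum>y\<le>n. ref_out n y * ln (ref_out n y / ?Q y))"
    unfolding rel_entropy_def by (intro sum.cong refl) auto
  have 1: "((\<lambda>t. \<Sum>y\<le>n. binom_kernel n ((sin t)\<^sup>2) y * ln (ref_out n y / ?Q y)) has_integral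
      (\<Sum>y\<le>n. pi / 2 * ref_out n y * ln (ref_out n y / ?Q y))) {0..pi/2}"
    by (intro has_integral_sum has_integral_mult_left has_integral_binom_kernel_sin) auto
  have "((\<lambda>t. l) has_integral ((pi/2 - \<alpha> - \<alpha>) * l)) ?J"
    using has_integral_const_real[of l \<alpha> "pi/2 - \<alpha>"] \<alpha> by simp
  then have 2: "((\<lambda>t. if t \<in> ?J then l else 0) has_integral ((pi/2 - \<alpha> - \<alpha>) * l)) {0..pi/2}"
    using \<alpha> by (subst has_integral_restrict) auto
  have "((\<lambda>t. ?C) has_integral (pi / 2 * ?C)) {0..pi/2}"
    using has_integral_const_real[of ?C 0 "pi/2"] by simp
  from has_integral_diff[OF this 2]
  have 3: "((\<lambda>t. ?C - (if t \<in> ?J then l else 0)) has_integral (pi / 2 * ?C - (pi/2 - \<alpha> - \<alpha>) * l)) {0..pi/2}" .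
  have "(\<Sum>y\<le>n. pi / 2 * ref_out n y * ln (ref_out n y / ?Q y)) \<le> pi / 2 * ?C - (pi/2 - \<alpha> - \<alpha>) * l"
  proof (rule has_integral_le[OF 1 3])
    fix t :: real assume "t \<in> {0..pi/2}"
    have x: "0 \<le> (sin t)\<^sup>2" "(sin t)\<^sup>2 \<le> 1" by (auto simp: abs_square_le_1)
    \<comment> \<open>On the discarded angles the divergence is only known to be nonnegative; the
      kept angles form the fraction \<open>1 - 4 * \<alpha> / pi\<close> of the interval.\<close>
    have "(if t \<in> ?J then l else 0) \<le> kernel_div n ((sin t)\<^sup>2) (ref_out n)"
      using l kernel_div_nonneg[of n "ref_out n" "(sin t)\<^sup>2"] x ref_out_pos by (auto simp: sum_ref_out)
    moreover have "kernel_div n ((sin t)\<^sup>2) ?Q \<le> ?C" using capacity_kkt[OF cap x] .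
    moreover have "kernel_div n ((sin t)\<^sup>2) ?Q = kernel_div n ((sin t)\<^sup>2) (ref_out n)
        + (\<Sum>y\<le>n. binom_kernel n ((sin t)\<^sup>2) y * ln (ref_out n y / ?Q y))"
      using Q ref_out_pos x by (intro kernel_div_eq) auto
    ultimately show "(\<Sum>y\<le>n. binom_kernel n ((sin t)\<^sup>2) y * ln (ref_out n y / ?Q y)) \<le> ?C - (if t \<in> ?J then l else 0)"
      by linarith
  qed
  also have "(\<Sum>y\<le>n. pi / 2 * ref_out n y * ln (ref_out n y / ?Q y)) = pi / 2 * rel_entropy n (ref_out n) ?Q"
    unfolding re by (simp only: sum_distrib_left mult.assoc)
  also have "pi / 2 * ?C - (pi/2 - \<alpha> - \<alpha>) * l = pi / 2 * (?C - (1 - 4 * \<alpha> / pi) * l)"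
    by (simp add: field_simps)
  finally show ?thesis by simp
qed

text \<open>Jordan's inequality: the concave sine lies above its chord.\<close>

lemma sin_ge_linear:
  assumes "0 \<le> t" "t \<le> pi / 2" shows "2 * t / pi \<le> sin t"
proof -
  have "convex_on {0..pi/2} (\<lambda>x. - sin x)"
  proof (rule f''_ge0_imp_convex[where f' = "\<lambda>x. - cos x" and f'' = sin])
    fix x :: real assume "x \<in> {0..pi/2}"
    then show "0 \<le> sin x" by (intro sin_ge_zero) auto
  qed (auto intro!: derivative_eq_intros)
  moreover have "0 \<le> 2 * t / pi" "2 * t / pi \<le> 1" using assms by auto
  ultimately have "- sin ((1 - 2 * t / pi) *\<^sub>R 0 + (2 * t / pi) *\<^sub>R (pi / 2)) \<le> (1 - 2 * t / pi) * - sin 0 + (2 * t / pi) * - sin (pi / 2)"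
    by (intro convex_onD[where A = "{0..pi/2}"]) auto
  then show ?thesis by simp
qed

text \<open>The left-hand side is \<open>(sin (2 * t))\<^sup>2 / 4\<close>. Both
  \<open>2 * t\<close> and \<open>pi - 2 * t\<close> are at least \<open>2 * \<alpha>\<close>, and
  Jordan's inequality applies to the smaller one.\<close>

lemma sin_squared_variance_ge:
  assumes "0 \<le> \<alpha>" "\<alpha> \<le> t" "t \<le> pi / 2 - \<alpha>"
  shows "(sin t)\<^sup>2 * (1 - (sin t)\<^sup>2) \<ge> 4 * \<alpha>\<^sup>2 / pi\<^sup>2"
proof -
  have "4 * \<alpha> / pi \<le> sin (2 * t)"
  proof (cases "2 * t \<le> pi / 2")
    case True
    have "4 * \<alpha> / pi \<le> 2 * (2 * t) / pi" using assms by (intro divide_right_mono) auto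
    then show ?thesis using sin_ge_linear[of "2 * t"] True assms by simp
  next
    case False
    have "4 * \<alpha> / pi \<le> 2 * (pi - 2 * t) / pi" using assms by (intro divide_right_mono) auto
    also have "\<dots> \<le> sin (pi - 2 * t)" using False assms by (intro sin_ge_linear) auto
    finally show ?thesis by simp
  qed
  then have "(4 * \<alpha> / pi)\<^sup>2 \<le> (sin (2 * t))\<^sup>2" using assms by (intro power_mono) auto
  also have "\<dots> = 4 * ((sin t)\<^sup>2 * (1 - (sin t)\<^sup>2))"
    by (simp add: sin_double cos_squared_eq[symmetric] power_mult_distrib)
  finally show ?thesis by (simp add: power_divide power_mult_distrib)
qed

lemma cube_root_variance:
  assumes "n \<ge> 1" "pi / (2 * root 3 (real n)) \<le> t" "t \<le> pi / 2 - pi / (2 * root 3 (real n))"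
  shows "root 3 (real n) \<le> real n * (sin t)\<^sup>2 * (1 - (sin t)\<^sup>2)"
proof -
  define u where "u = root 3 (real n)"
  have u: "u > 0" "u ^ 3 = real n" using assms(1) by (simp_all add: u_def)
  have "4 * (pi / (2 * u))\<^sup>2 / pi\<^sup>2 \<le> (sin t)\<^sup>2 * (1 - (sin t)\<^sup>2)"
    using assms u by (intro sin_squared_variance_ge) (auto simp: u_def[symmetric])
  moreover have "4 * (pi / (2 * u))\<^sup>2 / pi\<^sup>2 = 1 / u\<^sup>2"
    using u by (simp add: power_divide power_mult_distrib)
  ultimately have "u ^ 3 * (1 / u\<^sup>2) \<le> u ^ 3 * ((sin t)\<^sup>2 * (1 - (sin t)\<^sup>2))"
    using u by (intro mult_left_mono) auto
  moreover have "u ^ 3 * (1 / u\<^sup>2) = u" using u(1) by (simp add: power3_eq_cube power2_eq_square)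
  ultimately show ?thesis unfolding u(2) u_def[symmetric] by (simp add: mult.assoc)
qed

lemma sin_squared_in_unit:
  assumes "0 < n * (sin t)\<^sup>2 * (1 - (sin t)\<^sup>2)" "0 \<le> n"
  shows "0 < (sin t)\<^sup>2" "(sin t)\<^sup>2 < (1::real)"
proof -
  have "(sin t)\<^sup>2 \<le> 1" by (simp add: abs_square_le_1)
  moreover have "(sin t)\<^sup>2 \<noteq> 0" "(sin t)\<^sup>2 \<noteq> 1" using assms by auto
  ultimately show "0 < (sin t)\<^sup>2" "(sin t)\<^sup>2 < 1" by (auto simp: order_less_le)
qed

lemma root3_bounds:
  assumes "n \<ge> 300"
  shows "root 3 (real n) \<ge> 33/5" "root 3 (real n) ^ 3 = real n"
proof -
  have "root 3 ((33/5) ^ 3) \<le> root 3 (real n)" using assms by (intro real_root_le_mono) (auto simp: power3_eq_cube)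
  then show "root 3 (real n) \<ge> 33/5" by (simp add: real_root_power_cancel)
  show "root 3 (real n) ^ 3 = real n" by simp
qed

lemma capacity_rel_entropy_bound:
  fixes n :: nat
  assumes cap: "capacity_achieving n M" and n: "n \<ge> 300"
  defines "L \<equiv> ln (real n * pi / (2 * exp 1))" and "u \<equiv> root 3 (real n)"
  shows "rel_entropy n (ref_out n) (out_dist n M) \<le> mutual_info n M - L / 2 + (L + 12/5) / u"
    and "mutual_info n M \<ge> L / 2 - (L + 12/5) / u"
proof -
  have u: "u \<ge> 33/5" using root3_bounds[OF n] by (simp add: u_def)
  have M: "input_dist M" using cap by (simp add: capacity_achieving_def)
  define \<alpha> where "\<alpha> = pi / (2 * u)"
  have "pi / (2 * u) \<le> pi / 4" using u by (intro divide_left_mono) auto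
  then have \<alpha>: "0 \<le> \<alpha>" "\<alpha> \<le> pi / 4" using u by (simp_all add: \<alpha>_def)
  have low: "L / 2 - 12/5 / u \<le> kernel_div n ((sin t)\<^sup>2) (ref_out n)" if t: "\<alpha> \<le> t" "t \<le> pi / 2 - \<alpha>" for t
  proof -
    have v: "u \<le> real n * (sin t)\<^sup>2 * (1 - (sin t)\<^sup>2)"
      using cube_root_variance[of n t] t n by (simp add: u_def \<alpha>_def)
    have v0: "0 < real n * (sin t)\<^sup>2 * (1 - (sin t)\<^sup>2)" using v u by linarith
    have s: "0 < (sin t)\<^sup>2" "(sin t)\<^sup>2 < 1" using sin_squared_in_unit[OF v0] by auto
    have "L / 2 - 12/5 / u \<le> L / 2 - 12/5 / (real n * (sin t)\<^sup>2 * (1 - (sin t)\<^sup>2))"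
      using v u v0 by (intro diff_left_mono divide_left_mono) auto
    also have "\<dots> \<le> kernel_div n ((sin t)\<^sup>2) (ref_out n)"
      unfolding L_def using v u n by (intro kernel_div_ref_out_lower s) auto
    finally show ?thesis .
  qed
  have "rel_entropy n (ref_out n) (out_dist n M) \<le> mutual_info n M - (1 - 4 * \<alpha> / pi) * (L / 2 - 12/5 / u)"
    by (rule capacity_rel_entropy_le[OF cap \<alpha> low])
  \<comment> \<open>Here \<open>4 * \<alpha> / pi = 2 / u\<close>. The cross term
    \<open>24/5 / u\<^sup>2\<close> is favourable and dropped afterwards.\<close>
  also have "(1 - 4 * \<alpha> / pi) * (L / 2 - 12/5 / u) = L / 2 - (L + 12/5) / u + 24/5 / u\<^sup>2"
    using u by (simp add: \<alpha>_def divide_simps power2_eq_square) (simp add: algebra_simps)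
  finally have "rel_entropy n (ref_out n) (out_dist n M) \<le> mutual_info n M - (L / 2 - (L + 12/5) / u + 24/5 / u\<^sup>2)" .
  moreover have "24/5 / u\<^sup>2 \<ge> 0" by simp
  ultimately show r: "rel_entropy n (ref_out n) (out_dist n M) \<le> mutual_info n M - L / 2 + (L + 12/5) / u" by linarith
  have "(\<Sum>y\<le>n. ref_out n y * ln (ref_out n y / out_dist n M y)) \<ge> 0"
    using capacity_out_dist_pos[OF cap] by (intro gibbs_inequality) (auto simp: sum_ref_out sum_out_dist[OF M] less_imp_le[OF ref_out_pos])
  moreover have "(\<Sum>y\<le>n. ref_out n y * ln (ref_out n y / out_dist n M y)) = rel_entropy n (ref_out n) (out_dist n M)"
    unfolding rel_entropy_def by (intro sum.cong refl) auto
  ultimately show "mutual_info n M \<ge> L / 2 - (L + 12/5) / u" using r by linarith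
qed

text \<open>The excess \<open>(1 + ln 2) / 2 + 1 / n\<close> is at most
  \<open>(1 + 25/36) / 2 + 1/300\<close>, just below \<open>851/1000\<close>.\<close>

lemma kernel_div_ref_out_coarse:
  assumes "n \<ge> 300" "0 \<le> x" "x \<le> 1"
  shows "kernel_div n x (ref_out n) \<le> ln (real n * pi / (2 * exp 1)) / 2 + 851/1000"
proof -
  have "kernel_div n x (ref_out n) \<le> ln (real n * pi) / 2 + 1 / real n"
    using assms by (intro kernel_div_ref_out_le) auto
  moreover have "ln (real n * pi / (2 * exp 1)) = ln (real n * pi) - ln 2 - 1"
    using assms by (simp add: ln_div ln_mult)
  moreover have "1 / real n \<le> 1 / 300" using assms by (intro divide_left_mono) auto
  ultimately show ?thesis using ln2_le_25_over_36 by linarith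
qed

lemma capacity_coarse:
  assumes cap: "capacity_achieving n M" and n: "n \<ge> 300"
  shows "mutual_info n M \<le> ln (real n * pi / (2 * exp 1)) / 2 + 851/1000"
proof -
  have M: "input_dist M" using cap by (simp add: capacity_achieving_def)
  interpret prob_space M using M by (simp add: input_dist_def)
  have "mutual_info n M \<le> (\<integral>x. kernel_div n x (ref_out n) \<partial>M)" by (rule mutual_info_le_integral_kernel_div_ref[OF cap])
  also have "\<dots> \<le> (\<integral>x. ln (real n * pi / (2 * exp 1)) / 2 + 851/1000 \<partial>M)"
    using n ref_out_pos by (intro input_dist_integral_mono[OF M] integrable_kernel_div M kernel_div_ref_out_coarse) auto
  finally show ?thesis using prob_space by simp
qed

text \<open>Integrate the divergence from the reference over the optimal input. Away from the
  endpoints \<open>v \<ge> u\<close> limits its excess over \<open>L / 2\<close> to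
  \<open>3/5 / u\<close>; on the two end zones the coarse excess is weighted by their mass, which
  the block bound controls.\<close>

lemma capacity_fine:
  fixes K :: nat
  assumes cap: "capacity_achieving n M" and n: "n \<ge> 300" and K: "real K \<ge> 2 * sqrt (real n)"
  defines "L \<equiv> ln (real n * pi / (2 * exp 1))" and "u \<equiv> root 3 (real n)"
  shows "mutual_info n M \<le> L / 2 + 3/5 / u + 851/1000 * (2 * (2 * real K / u + 1) * exp (pi\<^sup>2 / 16 - mutual_info n M))"
proof -
  have M: "input_dist M" using cap by (simp add: capacity_achieving_def)
  interpret prob_space M using M by (simp add: input_dist_def)
  have sM: "sets M = sets borel" using M by (simp add: input_dist_def)
  have n1: "n \<ge> 1" using n by simp
  have u: "u \<ge> 33/5" using root3_bounds[OF n] by (simp add: u_def)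
  have "2 * sqrt (real n) \<ge> 2 * sqrt 1" using n by (intro mult_left_mono real_sqrt_le_mono) auto
  then have K2: "real K \<ge> 2" using K unfolding real_sqrt_one by linarith
  define \<delta> where "\<delta> = pi / (4 * real K)"
  have \<delta>: "\<delta> > 0" "real (2 * K) * \<delta> = pi / 2" using K2 by (simp_all add: \<delta>_def)
  define \<kappa> where "\<kappa> = exp (pi\<^sup>2 / 16 - mutual_info n M)"
  \<comment> \<open>\<open>2 * K / u\<close> blocks of width \<open>pi / (4 * K)\<close> reach
    exactly the cut-off \<open>pi / (2 * u)\<close>; rounding up is the \<open>+ 1\<close> in the
    bound.\<close>
  define r where "r = nat \<lceil>2 * real K / u\<rceil>"
  have pos: "2 * real K / u > 0" using K2 u by simp
  have r: "2 * real K / u \<le> real r" "real r \<le> 2 * real K / u + 1" "r > 0"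
    using pos unfolding r_def by (linarith+)
  have "2 * real K / u \<le> 2 * real K / 2" using K2 u by (intro divide_left_mono) auto
  then have "real r \<le> 2 * real K" using r(2) K2 by linarith
  then have rK: "r \<le> 2 * K" by linarith
  have r\<delta>: "pi / (2 * u) \<le> real r * \<delta>"
  proof -
    have "pi / (2 * u) = 2 * real K / u * \<delta>" using K2 u by (simp add: \<delta>_def field_simps)
    also have "\<dots> \<le> real r * \<delta>" using r(1) \<delta> by (intro mult_right_mono) auto
    finally show ?thesis .
  qed
  define E where "E = {(sin (real 0 * \<delta>))\<^sup>2..(sin (real r * \<delta>))\<^sup>2} \<union> {(sin (real (2 * K - r) * \<delta>))\<^sup>2..(sin (real (2 * K) * \<delta>))\<^sup>2}"
  have "prob E \<le> prob {(sin (real 0 * \<delta>))\<^sup>2..(sin (real r * \<delta>))\<^sup>2} + prob {(sin (real (2 * K - r) * \<delta>))\<^sup>2..(sin (real (2 * K) * \<delta>))\<^sup>2}"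
    unfolding E_def using sM by (intro measure_Un_le) auto
  also have "\<dots> \<le> (real r - real 0) * \<kappa> + (real (2 * K) - real (2 * K - r)) * \<kappa>"
    unfolding \<kappa>_def \<delta>_def using r rK by (intro add_mono capacity_interval_mass[OF cap n1 K]) auto
  also have "\<dots> = 2 * real r * \<kappa>" using rK by (simp add: algebra_simps)
  also have "\<dots> \<le> 2 * (2 * real K / u + 1) * \<kappa>" using r(2) by (intro mult_right_mono) (auto simp: \<kappa>_def)
  finally have E: "prob E \<le> 2 * (2 * real K / u + 1) * \<kappa>" .
  have Es: "E \<in> sets M" unfolding E_def using sM by auto
  have "mutual_info n M \<le> (\<integral>x. kernel_div n x (ref_out n) \<partial>M)" by (rule mutual_info_le_integral_kernel_div_ref[OF cap])
  also have "\<dots> \<le> (\<integral>x. (L / 2 + 3/5 / u) + indicator E x * (851/1000) \<partial>M)"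
  proof (rule input_dist_integral_mono[OF M])
    show "integrable M (\<lambda>x. kernel_div n x (ref_out n))" by (intro integrable_kernel_div M ref_out_pos)
    show "integrable M (\<lambda>x. (L / 2 + 3/5 / u) + indicator E x * (851/1000))" using Es by (auto simp: emeasure_eq_measure)
    fix x :: real assume x: "0 \<le> x" "x \<le> 1"
    show "kernel_div n x (ref_out n) \<le> (L / 2 + 3/5 / u) + indicator E x * (851/1000)"
    proof (cases "x \<in> E")
      case True
      then have ind: "indicator E x = (1::real)" by simp
      have "3/5 / u \<ge> 0" using u by simp
      then show ?thesis using kernel_div_ref_out_coarse[OF n x] unfolding ind L_def by linarith
    next
      case False
      have "\<exists>t\<ge>0. t \<le> pi / 2 \<and> (sin t)\<^sup>2 = x"
        using x by (intro IVT') (auto intro!: continuous_intros)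
      then obtain t where t: "0 \<le> t" "t \<le> pi / 2" "x = (sin t)\<^sup>2" by auto
      have "t \<ge> real r * \<delta>"
      proof (rule ccontr)
        assume "\<not> ?thesis"
        moreover have "real r * \<delta> \<le> pi / 2"
          unfolding \<delta>(2)[symmetric] using rK \<delta> by (intro mult_right_mono) auto
        ultimately have "(sin t)\<^sup>2 \<le> (sin (real r * \<delta>))\<^sup>2" using t \<delta> by (intro sin_squared_mono) auto
        then show False using False t by (simp add: E_def)
      qed
      moreover have "t \<le> pi / 2 - real r * \<delta>"
      proof (rule ccontr)
        assume "\<not> ?thesis"
        moreover have eq: "real (2 * K - r) * \<delta> = pi / 2 - real r * \<delta>"
          using rK \<delta>(2) by (simp add: of_nat_diff left_diff_distrib)
        moreover have "0 \<le> real (2 * K - r) * \<delta>" using \<delta>(1) by (intro mult_nonneg_nonneg) auto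
        ultimately have "(sin (real (2 * K - r) * \<delta>))\<^sup>2 \<le> (sin t)\<^sup>2"
          using t by (intro sin_squared_mono) linarith+
        moreover have "(sin t)\<^sup>2 \<le> (sin (real (2 * K) * \<delta>))\<^sup>2" unfolding \<delta>(2) by (simp add: abs_square_le_1)
        ultimately show False using False t by (simp add: E_def)
      qed
      ultimately have v: "u \<le> real n * (sin t)\<^sup>2 * (1 - (sin t)\<^sup>2)"
        using cube_root_variance[OF n1, of t] r\<delta> unfolding u_def by linarith
      have v0: "0 < real n * (sin t)\<^sup>2 * (1 - (sin t)\<^sup>2)" using v u by linarith
      have "kernel_div n x (ref_out n) \<le> L / 2 + 3/5 / (real n * (sin t)\<^sup>2 * (1 - (sin t)\<^sup>2))"
        unfolding t(3) L_def using sin_squared_in_unit[OF v0] n1 by (intro kernel_div_ref_out_upper) auto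
      also have "\<dots> \<le> L / 2 + 3/5 / u" using v u v0 by (intro add_left_mono divide_left_mono) auto
      finally show ?thesis using False by simp
    qed
  qed
  also have "\<dots> = L / 2 + 3/5 / u + 851/1000 * prob E"
    using Es sets.sets_into_space[OF Es] prob_space by (simp add: emeasure_eq_measure Int_absorb2)
  also have "\<dots> \<le> L / 2 + 3/5 / u + 851/1000 * (2 * (2 * real K / u + 1) * \<kappa>)" using E by simp
  finally show ?thesis unfolding \<kappa>_def .
qed

subsection \<open>Numerical constants and the theorem\<close>

lemma exp_1_bounds: "exp 1 \<ge> (2718/1000 :: real)" "exp 1 \<le> (272/100 :: real)"
  using e_approx_32 e_less_272 by (simp_all add: abs_if split: if_splits)

lemma pi_bounds: "pi \<ge> 3141/1000" "pi \<le> 31416/10000"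
  using pi_approx by auto

lemma exp_minus_half_log_le:
  fixes n :: nat
  assumes "n \<ge> 1"
  shows "exp (- (ln (real n * pi / (2 * exp 1)) / 2)) \<le> 133/100 / sqrt (real n)"
proof (rule power2_le_imp_le)
  have "real n * pi / (2 * exp 1) > 0" using assms by simp
  then have "(exp (- (ln (real n * pi / (2 * exp 1)) / 2)))\<^sup>2 = 2 * exp 1 / (real n * pi)"
    by (simp add: exp_minus power_inverse flip: exp_double)
  also have "\<dots> = 2 * exp 1 / pi / real n" by (simp add: mult.commute)
  also have "\<dots> \<le> (133/100)\<^sup>2 / real n"
  proof (rule divide_right_mono)
    \<comment> \<open>\<open>2 * e / pi\<close> is about \<open>1.731\<close>, and
      \<open>(133/100)\<^sup>2 = 1.7689\<close>.\<close>
    have "2 * exp 1 \<le> (133/100)\<^sup>2 * pi" using exp_1_bounds pi_bounds by (simp add: power2_eq_square)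
    then show "2 * exp 1 / pi \<le> (133/100)\<^sup>2" by (simp add: divide_le_eq)
  qed simp
  also have "\<dots> = (133/100 / sqrt (real n))\<^sup>2" by (simp add: power_divide)
  finally show "(exp (- (ln (real n * pi / (2 * exp 1)) / 2)))\<^sup>2 \<le> (133/100 / sqrt (real n))\<^sup>2" .
qed simp

text \<open>\<open>31/50\<close> bounds \<open>pi\<^sup>2 / 16\<close>. The slack \<open>e\<close>
  is a parameter so that \<open>31/50 + e\<close> can be made \<open>3\<close> for every
  \<open>n \<ge> 300\<close> and \<open>1\<close> for large \<open>n\<close>, where the exponential
  is a power of \<open>exp 1\<close>.\<close>

lemma capacity_block_constant:
  fixes n :: nat and e :: real
  assumes cap: "capacity_achieving n M" and n: "n \<ge> 300"
    and e: "(ln (real n * pi / (2 * exp 1)) + 12/5) / root 3 (real n) \<le> e"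
  shows "exp (pi\<^sup>2 / 16 - mutual_info n M) \<le> exp (31/50 + e) * (133/100 / sqrt (real n))"
proof -
  have "pi\<^sup>2 \<le> (31416/10000)\<^sup>2" using pi_bounds by (intro power_mono) auto
  then have "pi\<^sup>2 / 16 \<le> 31/50" by (simp add: power2_eq_square)
  then have "pi\<^sup>2 / 16 - mutual_info n M \<le> (31/50 + e) + (- (ln (real n * pi / (2 * exp 1)) / 2))"
    using capacity_rel_entropy_bound(2)[OF cap n] e by linarith
  then have "exp (pi\<^sup>2 / 16 - mutual_info n M) \<le> exp (31/50 + e) * exp (- (ln (real n * pi / (2 * exp 1)) / 2))"
    by (simp only: exp_add[symmetric] exp_le_cancel_iff)
  also have "\<dots> \<le> exp (31/50 + e) * (133/100 / sqrt (real n))"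
    using n by (intro mult_left_mono exp_minus_half_log_le) auto
  finally show ?thesis .
qed

text \<open>As \<open>pi < 2 * e\<close>, the logarithm is at most \<open>3 * ln u\<close>, and
  \<open>ln u \<le> u / e\<close>. The generous \<open>119/50\<close> is
  \<open>3 - 31/50\<close>.\<close>

lemma log_cube_root_le:
  fixes n :: nat
  assumes n: "n \<ge> 300"
  shows "(ln (real n * pi / (2 * exp 1)) + 12/5) / root 3 (real n) \<le> 119/50"
proof -
  define u where "u = root 3 (real n)"
  have u: "u \<ge> 33/5" "u ^ 3 = real n" using root3_bounds[OF n] by (simp_all add: u_def)
  have "real n * pi / (2 * exp 1) \<le> real n"
    using pi_bounds exp_1_bounds n by (simp add: divide_le_eq)
  then have "ln (real n * pi / (2 * exp 1)) \<le> ln (u ^ 3)" unfolding u(2) using n by (subst ln_le_cancel_iff) auto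
  also have "\<dots> = 3 * ln u" using ln_realpow[of u 3] u(1) by (simp only: of_nat_numeral)
  also have "\<dots> \<le> 3 * (u / exp 1)"
    using ln_le_minus_one[of "u / exp 1"] u by (simp add: ln_div)
  also have "\<dots> \<le> 3 * (u / (5/2))"
    using exp_1_bounds u by (intro mult_left_mono divide_left_mono) auto
  finally have "ln (real n * pi / (2 * exp 1)) + 12/5 \<le> 119/50 * u" using u by simp
  then show ?thesis using u unfolding u_def[symmetric] by (simp add: divide_le_eq)
qed

lemma block_count:
  fixes n :: nat
  assumes "n \<ge> 300"
  obtains K :: nat where "real K \<ge> 2 * sqrt (real n)" "2 * real K \<le> 4 * sqrt (real n) + 2"
proof
  have "2 * sqrt (real n) \<ge> 0" by simp
  then show "real (nat \<lceil>2 * sqrt (real n)\<rceil>) \<ge> 2 * sqrt (real n)" "2 * real (nat \<lceil>2 * sqrt (real n)\<rceil>) \<le> 4 * sqrt (real n) + 2"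
    by linarith+
qed

lemma out_dist_le_ref_out:
  fixes n :: nat
  assumes cap: "capacity_achieving n M" and n: "n \<ge> 300" and y: "y \<le> n"
  shows "out_dist n M y \<le> 504 * ref_out n y"
proof -
  obtain K :: nat where K: "real K \<ge> 2 * sqrt (real n)" "2 * real K \<le> 4 * sqrt (real n) + 2"
    using block_count[OF n] .
  have n1: "n \<ge> 1" using n by simp
  define q where "q = sqrt (real n)"
  have "sqrt (4\<^sup>2) \<le> q" unfolding q_def using n by (intro real_sqrt_le_mono) simp
  then have q: "q \<ge> 4" by simp
  let ?R = "sqrt (real n * pi) * exp (1 / real n)"
  have R: "?R \<le> 2 * q"
  proof -
    have "sqrt pi \<le> sqrt ((18/10)\<^sup>2)" using pi_bounds by (intro real_sqrt_le_mono) (simp add: power2_eq_square)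
    then have a: "sqrt pi \<le> 18/10" by simp
    have "exp (1 / real n) \<le> exp (1/10)" using n by (simp add: field_simps)
    also have "\<dots> \<le> 111/100" using exp_bound[of "1/10"] by (simp add: power2_eq_square)
    finally have "sqrt pi * exp (1 / real n) \<le> 18/10 * (111/100)" using a by (intro mult_mono) auto
    then have "q * (sqrt pi * exp (1 / real n)) \<le> q * 2" using q by (intro mult_left_mono) auto
    then show ?thesis by (simp add: q_def real_sqrt_mult mult_ac)
  qed
  have r: "ref_out n y > 0" by (rule ref_out_pos[OF y])
  have "exp (pi\<^sup>2 / 16 - mutual_info n M) \<le> exp (31/50 + 119/50) * (133/100 / q)"
    unfolding q_def by (rule capacity_block_constant[OF cap n log_cube_root_le[OF n]])
  also have "exp (31/50 + 119/50 :: real) = exp 1 ^ 3" by (simp add: exp_of_nat_mult[symmetric])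
  also have "exp (1::real) ^ 3 * (133/100 / q) \<le> (272/100) ^ 3 * (133/100 / q)"
    using exp_1_bounds q by (intro mult_right_mono power_mono) auto
  finally have \<kappa>: "exp (pi\<^sup>2 / 16 - mutual_info n M) \<le> 27 / q" using q by (simp add: field_simps power3_eq_cube)
  have "out_dist n M y \<le> exp (pi\<^sup>2 / 16 - mutual_info n M) * (2 * real K * ref_out n y + 2 * (?R * ref_out n y))"
    using n1 y by (intro capacity_out_dist_le[OF cap n1 K(1) y] binom_kernel_le_ref_out) auto
  \<comment> \<open>\<open>5 * q\<close> bounds the number \<open>2 * K\<close> of blocks, and
    \<open>2 * q\<close> the ratio of the kernel to the reference.\<close>
  also have "\<dots> \<le> 27 / q * (5 * q * ref_out n y + 2 * (2 * q * ref_out n y))"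
  proof (intro mult_mono[OF \<kappa>] add_mono)
    show "2 * real K * ref_out n y \<le> 5 * q * ref_out n y"
      using K(2) q r unfolding q_def[symmetric] by (intro mult_right_mono) auto
    show "2 * (?R * ref_out n y) \<le> 2 * (2 * q * ref_out n y)"
      using R r by (intro mult_left_mono mult_right_mono) auto
  qed (use q r in auto)
  also have "\<dots> = 243 * ref_out n y" using q by (simp add: field_simps)
  also have "\<dots> \<le> 504 * ref_out n y" using r by simp
  finally show ?thesis .
qed

text \<open>The left-hand side is about \<open>551\<close>. Replacing \<open>pi\<close> by
  \<open>3\<close> leaves \<open>4 * e * 27 * sqrt 3\<close>, about \<open>508\<close>.\<close>

lemma ratio_constant_ge: "4 * exp 1 * 3 powr (7/4) * pi powr (7/4) \<ge> (504::real)"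
proof -
  have s: "sqrt 3 \<ge> (173/100::real)" by (rule real_le_rsqrt) (simp add: power2_eq_square)
  have "(3::real) powr (7/4) * pi powr (7/4) \<ge> 3 powr (7/4) * 3 powr (7/4)"
    using pi_bounds by (intro mult_left_mono powr_mono2) auto
  moreover have "(3::real) powr (7/4) * 3 powr (7/4) = 3 powr (3 + 1/2)" by (simp add: powr_add[symmetric])
  moreover have "(3::real) powr (3 + 1/2) = 27 * sqrt 3" by (simp only: powr_add powr_half_sqrt) (simp add: powr_half_sqrt)
  ultimately have "(3::real) powr (7/4) * pi powr (7/4) \<ge> 27 * (173/100)" using s by linarith
  then have "4 * (2718/1000) * (27 * (173/100)) \<le> 4 * exp 1 * ((3::real) powr (7/4) * pi powr (7/4))"
    using exp_1_bounds by (intro mult_mono[of "4 * (2718/1000)"]) auto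
  moreover have "(504::real) \<le> 4 * (2718/1000) * (27 * (173/100))" by simp
  ultimately show ?thesis unfolding mult.assoc by (rule order.trans[rotated])
qed

text \<open>For \<open>n < 300\<close> the trivial bound \<open>1\<close> on an output probability
  suffices, because \<open>ref_out_ge\<close> gives at least \<open>2 / (300 * pi)\<close>, about
  \<open>1 / 471\<close>. The constant \<open>504\<close> fits between this and the constant of the
  claim.\<close>

lemma capacity_ratio_ge:
  assumes cap: "capacity_achieving n M" and y: "y \<le> n"
  shows "ref_out n y / out_dist n M y \<ge> 1 / 504"
proof -
  have M: "input_dist M" using cap by (simp add: capacity_achieving_def)
  have Q: "out_dist n M y > 0" by (rule capacity_out_dist_pos[OF cap y])
  have "out_dist n M y \<le> 504 * ref_out n y"
  proof (cases "n \<ge> 300")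
    case True
    then show ?thesis by (rule out_dist_le_ref_out[OF cap _ y])
  next
    case False
    then have "pi * (real n + 1) \<le> 31416/10000 * 300" using pi_bounds by (intro mult_mono) auto
    then have "1 \<le> 504 * (2 / (pi * (real n + 1)))" by (simp add: le_divide_eq)
    also have "\<dots> \<le> 504 * ref_out n y" using ref_out_ge[OF y] by simp
    finally show ?thesis using out_dist_le_1[OF M y] by linarith
  qed
  then show ?thesis using Q by (simp add: le_divide_eq)
qed

text \<open>Writing \<open>L\<close> for the logarithm, \<open>n = (2 * e / pi) * exp L\<close>; the
  cube root of \<open>2 * e / pi\<close> is slightly above \<open>6/5\<close>.\<close>

lemma cube_root_ge_exp:
  fixes n :: nat
  assumes "n \<ge> 1"
  shows "root 3 (real n) \<ge> 6/5 * exp (ln (real n * pi / (2 * exp 1)) / 3)"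
proof -
  define L where "L = ln (real n * pi / (2 * exp 1))"
  have "exp L = real n * pi / (2 * exp 1)" unfolding L_def using assms by simp
  moreover have "(exp (L / 3)) ^ 3 = exp L" by (simp add: exp_of_nat_mult[symmetric])
  ultimately have "(6/5 * exp (L / 3)) ^ 3 = (6/5) ^ 3 * (real n * pi / (2 * exp 1))" by (simp only: power_mult_distrib)
  also have "\<dots> = (216/125 * pi / (2 * exp 1)) * real n" by (simp add: power3_eq_cube)
  also have "\<dots> \<le> 1 * real n"
    using pi_bounds exp_1_bounds by (intro mult_right_mono) (auto simp: divide_le_eq)
  finally have "(6/5 * exp (L / 3)) ^ 3 \<le> (root 3 (real n)) ^ 3" by simp
  then show ?thesis unfolding L_def[symmetric] by (subst (asm) power_mono_iff) auto
qed

lemma exp_2_ge: "exp 2 \<ge> (738/100 :: real)"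
proof -
  have "(2718/1000)\<^sup>2 \<le> (exp 1 :: real)\<^sup>2" using exp_1_bounds by (intro power_mono) auto
  moreover have "exp 2 = (exp 1 :: real)\<^sup>2" using exp_double[of "1::real"] by simp
  ultimately show ?thesis by (simp add: power2_eq_square)
qed

lemma capacity_rel_entropy_final:
  fixes n :: nat
  assumes cap: "capacity_achieving n M" and n: "n \<ge> 444"
  shows "rel_entropy n (ref_out n) (out_dist n M) \<le> 17 / ln (real n * pi / (2 * exp 1))"
proof -
  have n300: "n \<ge> 300" and n1: "n \<ge> 1" using n by auto
  define L where "L = ln (real n * pi / (2 * exp 1))"
  define u where "u = root 3 (real n)"
  define D where "D = rel_entropy n (ref_out n) (out_dist n M)"
  have u: "u \<ge> 33/5" "u ^ 3 = real n" using root3_bounds[OF n300] by (simp_all add: u_def)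
  have uL: "u \<ge> 6/5 * exp (L / 3)" unfolding u_def L_def by (rule cube_root_ge_exp[OF n1])
  have "2 * exp 1 < 444 * (3141/1000 :: real)" using exp_1_bounds by simp
  also have "\<dots> \<le> real n * pi" using n pi_bounds by (intro mult_mono) auto
  finally have "1 < real n * pi / (2 * exp 1)" by simp
  then have Lpos: "L > 0" unfolding L_def by (rule ln_gt_zero)
  have D1: "D \<le> mutual_info n M - L / 2 + (L + 12/5) / u"
    using capacity_rel_entropy_bound(1)[OF cap n300] by (simp add: D_def L_def u_def)
  have coarse: "mutual_info n M \<le> L / 2 + 851/1000" using capacity_coarse[OF cap n300] by (simp add: L_def)
  \<comment> \<open>At \<open>L = 6\<close> the quotient \<open>(L + 12/5) * L / u\<close> is at
    most about \<open>5.7\<close>. From there on \<open>u\<close> grows like \<open>exp w\<close>,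
    and a quadratic Taylor bound already dominates the numerator.\<close>
  have big: "(L + 12/5) * L \<le> 67/10 * u" if L6: "L \<ge> 6"
  proof -
    define w where "w = (L - 6) / 3"
    have w: "w \<ge> 0" "L = 6 + 3 * w" using L6 by (simp_all add: w_def field_simps)
    have "exp (L / 3) = exp 2 * exp w" by (simp add: exp_add[symmetric] w_def diff_divide_distrib)
    moreover have "exp 2 * exp w \<ge> 738/100 * (1 + w + w\<^sup>2 / 2)"
      using exp_lower_Taylor_quadratic[OF w(1)] exp_2_ge w by (intro mult_mono) auto
    ultimately have u2: "u \<ge> 6/5 * (738/100 * (1 + w + w\<^sup>2 / 2))" using uL by linarith
    have "(L + 12/5) * L = 252/5 + 216/5 * w + 9 * w\<^sup>2" unfolding w(2) by (simp add: power2_eq_square field_simps)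
    also have "\<dots> \<le> 67/10 * u" using u2 w(1) zero_le_power2[of w] by argo
    finally show ?thesis .
  qed
  have "D * L \<le> 17"
  proof -
    \<comment> \<open>The coarse capacity bound loses a constant, which after multiplication by
      \<open>L\<close> is affordable up to \<open>L = 12\<close>, the tightest point
      (\<open>10.212 + 6.7\<close>). Beyond it the fine bound, with loss of order
      \<open>1 / u\<close>, takes over; below \<open>6\<close> the bound \<open>u \<ge> 33/5\<close>
      replaces \<open>big\<close>.\<close>
    consider "L \<le> 6" | "6 \<le> L" "L \<le> 12" | "L \<ge> 12" by linarith
    then show ?thesis
    proof cases
      case 1
      have "(L + 12/5) / u \<le> (6 + 12/5) / (33/5)" using 1 u Lpos by (intro frac_le) auto
      then have "D \<le> 851/1000 + (6 + 12/5) / (33/5)" using D1 coarse by linarith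
      then have "D * L \<le> (851/1000 + (6 + 12/5) / (33/5)) * L" using Lpos by (intro mult_right_mono) auto
      also have "\<dots> \<le> (851/1000 + (6 + 12/5) / (33/5)) * 6" using 1 by (intro mult_left_mono) auto
      finally show ?thesis by simp
    next
      case 2
      have "D \<le> 851/1000 + (L + 12/5) / u" using D1 coarse by linarith
      then have "D * L \<le> (851/1000 + (L + 12/5) / u) * L" using Lpos by (intro mult_right_mono) auto
      also have "\<dots> = 851/1000 * L + (L + 12/5) * L / u" by (simp add: algebra_simps)
      also have "\<dots> \<le> 851/1000 * 12 + 67/10" using 2 big u by (intro add_mono) (auto simp: divide_le_eq)
      finally show ?thesis by simp
    next
      case 3
      have "exp (4::real) = (exp 2)\<^sup>2" using exp_double[of "2::real"] by simp
      then have e4: "exp 4 \<ge> (54::real)" using power_mono[OF exp_2_ge, of 2] by (simp add: power2_eq_square)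
      have "exp (L / 3) = exp 4 * exp ((L - 12) / 3)" by (simp add: exp_add[symmetric] diff_divide_distrib)
      moreover have "exp 4 * exp ((L - 12) / 3) \<ge> 54 * (1 + (L - 12) / 3)"
        using e4 exp_ge_add_one_self[of "(L - 12) / 3"] 3 by (intro mult_mono) auto
      ultimately have u2: "u \<ge> 6/5 * (54 * (1 + (L - 12) / 3))" using uL by linarith
      \<comment> \<open>The bound gives \<open>u \<ge> 64.8\<close> at \<open>L = 12\<close> and
        gains \<open>21.6\<close> per unit of \<open>L\<close>.\<close>
      have u64: "u \<ge> 64" and Lu: "L \<le> 19/100 * u" using u2 3 by (simp_all add: field_simps)
      define q where "q = sqrt (real n)"
      have q: "q \<ge> 8 * u"
      proof -
        have "64 * u\<^sup>2 \<le> u * u\<^sup>2" using u64 by (intro mult_right_mono) auto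
        then have "(8 * u)\<^sup>2 \<le> real n" unfolding u(2)[symmetric] by (simp add: power2_eq_square power3_eq_cube)
        then show ?thesis unfolding q_def by (rule real_le_rsqrt)
      qed
      obtain K :: nat where K: "real K \<ge> 2 * sqrt (real n)" "2 * real K \<le> 4 * sqrt (real n) + 2"
        using block_count[OF n300] .
      define \<kappa> where "\<kappa> = exp (pi\<^sup>2 / 16 - mutual_info n M)"
      \<comment> \<open>\<open>19/50\<close> makes the exponent in
        \<open>capacity_block_constant\<close> equal to \<open>1\<close>.\<close>
      have "(L + 12/5) / u \<le> 19/50" using Lu u64 by (simp add: divide_le_eq)
      then have "\<kappa> \<le> exp (31/50 + 19/50) * (133/100 / q)"
        unfolding \<kappa>_def q_def L_def u_def by (rule capacity_block_constant[OF cap n300])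
      also have "\<dots> \<le> 272/100 * (133/100 / q)" using exp_1_bounds q u by (intro mult_mono) auto
      also have "\<dots> = 272/100 * (133/100) / q" by simp
      also have "\<dots> \<le> 362/100 / q" using q u by (intro divide_right_mono) auto
      finally have \<kappa>: "\<kappa> \<le> 362/100 / q" .
      have "(2 * real K / u + 1) * \<kappa> \<le> ((4 * q + 2) / u + 1) * (362/100 / q)"
        using K(2) \<kappa> u64 q unfolding q_def[symmetric]
        by (intro mult_mono add_mono divide_right_mono) (auto simp: \<kappa>_def)
      also have "\<dots> = 362/100 * (4 / u + (2 / u + 1) * (1 / q))" using u64 q by (simp add: field_simps)
      also have "\<dots> \<le> 362/100 * (4 / u + (2 / 64 + 1) * (1 / (8 * u)))"
        using u64 q by (intro mult_left_mono add_mono mult_mono divide_left_mono) auto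
      also have "\<dots> \<le> 15 / u" using u64 by (simp add: field_simps)
      finally have "(2 * real K / u + 1) * \<kappa> \<le> 15 / u" .
      moreover have "mutual_info n M \<le> L / 2 + 3/5 / u + 851/1000 * (2 * (2 * real K / u + 1) * \<kappa>)"
        unfolding L_def u_def \<kappa>_def by (rule capacity_fine[OF cap n300 K(1)])
      ultimately have "mutual_info n M \<le> L / 2 + 3/5 / u + 851/500 * (15 / u)" unfolding mult.assoc by argo
      then have "D \<le> 3/5 / u + 851/500 * (15 / u) + (L + 12/5) / u" using D1 by linarith
      also have "\<dots> \<le> 27 / u + (L + 12/5) / u" using u64 by (simp add: field_simps)
      finally have "D * L \<le> (27 / u + (L + 12/5) / u) * L" using Lpos by (intro mult_right_mono) auto
      also have "\<dots> = 27 * L / u + (L + 12/5) * L / u" by (simp add: algebra_simps)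
      also have "\<dots> \<le> 27 * (19/100) + 67/10"
        using big 3 Lu u64 by (intro add_mono) (auto simp: divide_le_eq)
      finally show ?thesis by simp
    qed
  qed
  then show ?thesis using Lpos unfolding D_def L_def by (simp add: le_divide_eq)
qed

theorem theorem3:
  fixes n :: nat and M :: "real measure"
  assumes "n \<ge> 1" and "capacity_achieving n M"
  shows "(\<forall>y\<le>n. ref_out n y / out_dist n M y
              \<ge> 1 / (4 * exp 1 * 3 powr (7/4) * pi powr (7/4)))
       \<and> (n \<ge> 444 \<longrightarrow>
            rel_entropy n (ref_out n) (out_dist n M) \<le> 17 / ln (real n * pi / (2 * exp 1)))"
proof (intro conjI allI impI)
  fix y assume "y \<le> n"
  have "1 / (4 * exp 1 * 3 powr (7/4) * pi powr (7/4)) \<le> 1 / (504::real)"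
    using ratio_constant_ge by (intro divide_left_mono) auto
  also have "\<dots> \<le> ref_out n y / out_dist n M y" by (rule capacity_ratio_ge[OF assms(2) \<open>y \<le> n\<close>])
  finally show "ref_out n y / out_dist n M y \<ge> 1 / (4 * exp 1 * 3 powr (7/4) * pi powr (7/4))" .
next
  assume "n \<ge> 444"
  then show "rel_entropy n (ref_out n) (out_dist n M) \<le> 17 / ln (real n * pi / (2 * exp 1))"
    by (rule capacity_rel_entropy_final[OF assms(2)])
qed

end
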